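(* Let $K$ be a perfect field of characteristic $2$. (1) Let $V$ be a finite-dimensional vector space over $K$, $b$ a nondegenerate non-alternating symmetric bilinear form on $V$, and $\mathscr{F}\colon 0=V_0\subseteq V_1\subseteq V_2\subseteq\ldots$ a flag of subspaces with $V_q=V$ for all sufficiently large $q$. Then there is a basis of $V$ coordinated with the flag $\mathscr{F}$ relative to which the matrix of $b$ has the block-diagonal form $\mathrm{diag}(M_0,\ldots,M_0,M_1,\ldots,M_1,1_s)$, where $1_s$ is the identity matrix of size $s=\sum_{q\ge 1} n_{qq}n_{qq}^{1}$, the number of blocks $M_1$ is $\sum_{1\le q<r} n_{qr}n_{rq}^{1}$, and $$M_0=\begin{pmatrix}0&1\\1&0\end{pmatrix},\qquad M_1=\begin{pmatrix}0&1\\1&1\end{pmatrix}.$$ (2) Two triples $(V,\mathscr{F},b)$ and $(V',\mathscr{F}',b')$ of this kind are equivalent if and only if they have the same invariants $n_{qr}$ and $n_{qr}^{1}$ for all $q,r\ge 1$.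
   Context: A symmetric bilinear form $b$ on $V$ is non-alternating if $b(v,v)\ne 0$ for some $v\in V$. For a subspace $L\subseteq V$, $L^{\perp}$ denotes its orthogonal complement with respect to $b$. $V^0=\{v\in V\mid b(v,v)=0\}$; in characteristic $2$ over a perfect field it is a hyperplane of $V$. For $q,r\ge 1$ put $$\Phi_{qr}=(V_q\cap V_{r-1}^{\perp})\big/\bigl(V_q\cap V_r^{\perp}+V_{q-1}\cap V_{r-1}^{\perp}\bigr),$$ let $\Phi_{qr}^{0}$ be the image of $V_q\cap V_{r-1}^{\perp}\cap V^0$ under the canonical projection onto $\Phi_{qr}$, and set $$n_{qr}=\dim\Phi_{qr},\qquad n_{qr}^{1}=\dim\Phi_{qr}-\dim\Phi_{qr}^{0}\in\{0,1\}.$$ A basis of $V$ is coordinated with $\mathscr{F}$ if its intersection with each $V_j$ is a basis of $V_j$. Triples $(V,\mathscr{F},b)$ and $(V',\mathscr{F}',b')$ are equivalent if there is a linear isomorphism $V\to V'$ mapping the flag $\mathscr{F}$ onto $\mathscr{F}'$ (i.e. $V_j$ onto $V'_j$ for all $j$) and carrying the form $b$ to $b'$. *)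

theory Defs
  imports
    "HOL-Computational_Algebra.Computational_Algebra"
    "HOL-Library.Set_Algebras"
    "Jordan_Normal_Form.VS_Connect"
begin

definition perfect :: "'k::field itself \<Rightarrow> bool" where
  "perfect _ \<longleftrightarrow> CHAR('k) = 0 \<or> surj (\<lambda>x::'k. x ^ CHAR('k))"

subsection \<open>Flagged symmetric bilinear spaces\<close>

text \<open>
  The ambient space is the whole type \<open>'v\<close>, with scalar multiplication \<open>scale\<close>; a flag is a
  sequence \<open>F\<close> of subspaces, in which repetitions are allowed.
\<close>

locale flagged_space = vector_space scale
  for scale :: "'k::field \<Rightarrow> 'v::ab_group_add \<Rightarrow> 'v" +
  fixes b :: "'v \<Rightarrow> 'v \<Rightarrow> 'k"
    and F :: "nat \<Rightarrow> 'v set"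
  assumes finite_dimensional: "\<exists>B. finite B \<and> span B = UNIV"
    and linear_left: "Vector_Spaces.linear scale (*) (\<lambda>x. b x y)"
    and linear_right: "Vector_Spaces.linear scale (*) (\<lambda>y. b x y)"
    and symmetric: "b x y = b y x"
    and nondegenerate: "(\<forall>y. b x y = 0) \<Longrightarrow> x = 0"
    and non_alternating: "\<exists>v. b v v \<noteq> 0"
    and flag_subspace: "subspace (F q)"
    and flag_zero: "F 0 = {0}"
    and flag_mono: "F q \<subseteq> F (Suc q)"
    and flag_exhausts: "\<exists>N. \<forall>q\<ge>N. F q = UNIV"

definition equivalent_triples ::
  "('k::field \<Rightarrow> 'v::ab_group_add \<Rightarrow> 'v) \<Rightarrow> ('v \<Rightarrow> 'v \<Rightarrow> 'k) \<Rightarrow> (nat \<Rightarrow> 'v set) \<Rightarrow>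
   ('k \<Rightarrow> 'w::ab_group_add \<Rightarrow> 'w) \<Rightarrow> ('w \<Rightarrow> 'w \<Rightarrow> 'k) \<Rightarrow> (nat \<Rightarrow> 'w set) \<Rightarrow> bool" where
  "equivalent_triples scale b F scale' b' F' \<longleftrightarrow>
     (\<exists>f. Vector_Spaces.linear scale scale' f \<and> bij f \<and>
          (\<forall>j. f ` F j = F' j) \<and> (\<forall>x y. b' (f x) (f y) = b x y))"

definition orth :: "('v \<Rightarrow> 'v \<Rightarrow> 'k::zero) \<Rightarrow> 'v set \<Rightarrow> 'v set" where
  "orth b L = {v. \<forall>l\<in>L. b v l = 0}"

text \<open>The set \<open>V\<^sup>0\<close>.\<close>

definition isotropic :: "('v \<Rightarrow> 'v \<Rightarrow> 'k::zero) \<Rightarrow> 'v set" where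
  "isotropic b = {v. b v v = 0}"

subsection \<open>The invariants\<close>

text \<open>
  The quotient \<open>U / W\<close> of subspaces \<open>W \<subseteq> U\<close>, as a vector space of cosets. The summand \<open>W\<close> in the
  scalar multiplication matters only for the scalar \<open>0\<close>, which sends every coset to \<open>W\<close>.
  The record type of modules extends that of rings, whence the irrelevant fields \<open>mult\<close> and \<open>one\<close>.
\<close>

definition quotient_space ::
  "('k \<Rightarrow> 'v \<Rightarrow> 'v) \<Rightarrow> 'v set \<Rightarrow> 'v set \<Rightarrow> ('k::field, 'v::ab_group_add set) module" where
  "quotient_space scale U W =
     \<lparr>carrier = (\<lambda>v. v +o W) ` U, mult = undefined, one = undefined,
      zero = W, add = (\<lambda>X Y. X + Y), smult = (\<lambda>c X. scale c ` X + W)\<rparr>"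

definition Phi_num :: "('v \<Rightarrow> 'v \<Rightarrow> 'k::zero) \<Rightarrow> (nat \<Rightarrow> 'v set) \<Rightarrow> nat \<Rightarrow> nat \<Rightarrow> 'v set" where
  "Phi_num b F q r = F q \<inter> orth b (F (r - 1))"

definition Phi_den ::
  "('v::ab_group_add \<Rightarrow> 'v \<Rightarrow> 'k::zero) \<Rightarrow> (nat \<Rightarrow> 'v set) \<Rightarrow> nat \<Rightarrow> nat \<Rightarrow> 'v set" where
  "Phi_den b F q r = (F q \<inter> orth b (F r)) + (F (q - 1) \<inter> orth b (F (r - 1)))"

definition Phi ::
  "('k \<Rightarrow> 'v \<Rightarrow> 'v) \<Rightarrow> ('v \<Rightarrow> 'v \<Rightarrow> 'k) \<Rightarrow> (nat \<Rightarrow> 'v set) \<Rightarrow> nat \<Rightarrow> nat \<Rightarrow>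
   ('k::field, 'v::ab_group_add set) module" where
  "Phi scale b F q r = quotient_space scale (Phi_num b F q r) (Phi_den b F q r)"

definition Phi0 ::
  "('v \<Rightarrow> 'v \<Rightarrow> 'k::field) \<Rightarrow> (nat \<Rightarrow> 'v set) \<Rightarrow> nat \<Rightarrow> nat \<Rightarrow> 'v::ab_group_add set set" where
  "Phi0 b F q r = (\<lambda>v. v +o Phi_den b F q r) ` (Phi_num b F q r \<inter> isotropic b)"

definition n_inv ::
  "('k::field \<Rightarrow> 'v::ab_group_add \<Rightarrow> 'v) \<Rightarrow> ('v \<Rightarrow> 'v \<Rightarrow> 'k) \<Rightarrow> (nat \<Rightarrow> 'v set) \<Rightarrow>
   nat \<Rightarrow> nat \<Rightarrow> nat" where
  "n_inv scale b F q r = vectorspace.dim class_ring (Phi scale b F q r)"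

definition n1_inv ::
  "('k::field \<Rightarrow> 'v::ab_group_add \<Rightarrow> 'v) \<Rightarrow> ('v \<Rightarrow> 'v \<Rightarrow> 'k) \<Rightarrow> (nat \<Rightarrow> 'v set) \<Rightarrow>
   nat \<Rightarrow> nat \<Rightarrow> nat" where
  "n1_inv scale b F q r =
     vectorspace.dim class_ring (Phi scale b F q r) -
     vectorspace.dim class_ring (Phi scale b F q r\<lparr>carrier := Phi0 b F q r\<rparr>)"

text \<open>
  The sums below run over the indices with \<open>n\<^sub>q\<^sub>r \<noteq> 0\<close>. There are finitely many of these, since
  \<open>n\<^sub>q\<^sub>r = 0\<close> as soon as \<open>F (q - 1)\<close> or \<open>F (r - 1)\<close> is the whole space.
\<close>

definition size_one ::
  "('k::field \<Rightarrow> 'v::ab_group_add \<Rightarrow> 'v) \<Rightarrow> ('v \<Rightarrow> 'v \<Rightarrow> 'k) \<Rightarrow> (nat \<Rightarrow> 'v set) \<Rightarrow> nat" where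
  "size_one scale b F =
     (\<Sum>q | 1 \<le> q \<and> n_inv scale b F q q \<noteq> 0. n_inv scale b F q q * n1_inv scale b F q q)"

definition num_M1 ::
  "('k::field \<Rightarrow> 'v::ab_group_add \<Rightarrow> 'v) \<Rightarrow> ('v \<Rightarrow> 'v \<Rightarrow> 'k) \<Rightarrow> (nat \<Rightarrow> 'v set) \<Rightarrow> nat" where
  "num_M1 scale b F =
     (\<Sum>(q, r) | 1 \<le> q \<and> q < r \<and> n_inv scale b F q r \<noteq> 0.
        n_inv scale b F q r * n1_inv scale b F r q)"

subsection \<open>Bases and matrices\<close>

definition (in vector_space) basis_of :: "'b set \<Rightarrow> 'b set \<Rightarrow> bool" where
  "basis_of B S \<longleftrightarrow> independent B \<and> span B = S"

text \<open>
  The order of the list fixes the order of rows and columns of the matrix of \<open>b\<close>; it is not related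
  to the flag.
\<close>

definition (in vector_space) coordinated_basis :: "(nat \<Rightarrow> 'b set) \<Rightarrow> 'b list \<Rightarrow> bool" where
  "coordinated_basis F es \<longleftrightarrow>
     distinct es \<and> basis_of (set es) UNIV \<and> (\<forall>j. basis_of (set es \<inter> F j) (F j))"

definition matrix_of_form :: "('v \<Rightarrow> 'v \<Rightarrow> 'k) \<Rightarrow> 'v list \<Rightarrow> 'k mat" where
  "matrix_of_form b es = mat (length es) (length es) (\<lambda>(i, j). b (es ! i) (es ! j))"

definition M0 :: "'k::{zero,one} mat" where
  "M0 = mat_of_rows_list 2 [[0, 1], [1, 0]]"

definition M1 :: "'k::{zero,one} mat" where
  "M1 = mat_of_rows_list 2 [[0, 1], [1, 1]]"

end

theory Submission
  imports Defs
begin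

text \<open>
  Let \<open>V\<^sup>0\<close> be the set of isotropic vectors. In characteristic \<open>2\<close> the value \<open>b v v\<close> is additive in \<open>v\<close>,
  and over a perfect field it is the square of a linear functional, whose kernel is \<open>V\<^sup>0\<close>. The form
  pairs \<open>\<Phi>\<^sub>q\<^sub>r\<close> with \<open>\<Phi>\<^sub>r\<^sub>q\<close> nondegenerately (\<open>num_den_duality\<close>). Hence a nonzero class in \<open>\<Phi>\<^sub>q\<^sub>r\<close>
  has a representative \<open>f\<close> with a partner \<open>e\<close> representing a class in \<open>\<Phi>\<^sub>r\<^sub>q\<close>, and the span of \<open>e\<close> and \<open>f\<close>
  is an orthogonal summand compatible with the flag (\<open>flag_summand_pair\<close>). Iteration decomposes
  the triple into blocks of size one or two.

  It remains to control the diagonal of the Gram matrix. One has \<open>n\<^sup>1\<^sub>q\<^sub>r = 1\<close> precisely if the numerator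
  of \<open>\<Phi>\<^sub>q\<^sub>r\<close> is not contained in \<open>V\<^sup>0\<close> but the denominator is (\<open>n1_inv_eq_corner\<close>). Such a pair \<open>(q, r)\<close>
  is called a corner; it satisfies \<open>r \<le> q\<close>, because for \<open>q < r\<close> the numerator is orthogonal to
  itself. Away from the corners every class can be represented by an isotropic vector, so isotropic
  blocks \<open>M\<^sub>0\<close> can be split off there, and the complement has the same corners. Once only corners
  are left, blocks \<open>M\<^sub>1\<close> (for \<open>r < q\<close>) or \<open>1\<close> (for \<open>r = q\<close>) are split off. With some care in
  the choice of \<open>f\<close> and \<open>e\<close>, a corner stays a corner until its \<open>\<Phi>\<^sub>q\<^sub>r\<close> is used up (\<open>corner_pair\<close>,
  \<open>corner_single\<close>, \<open>corner_complement\<close>). The outcome (\<open>normal_basis_exists\<close>) is a basis with an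
  involution \<open>\<sigma>\<close> such that \<open>b x x\<close> is \<open>1\<close> or \<open>0\<close> according to whether the levels of \<open>x\<close> and \<open>\<sigma> x\<close>
  form a corner, \<open>b x (\<sigma> x) = 1\<close>, and all other values of the form vanish; the fixed points of \<open>\<sigma>\<close>
  are the \<open>x\<close> for which the two levels agree and form a corner. Here the level of \<open>x\<close> is the
  least \<open>j\<close> with \<open>x \<in> F j\<close>.

  In such a basis \<open>n\<^sub>q\<^sub>r\<close> is the number of basis vectors of level \<open>q\<close> whose partner has level \<open>r\<close>
  (\<open>n_inv_eq_card\<close>), because the spaces \<open>F q \<inter> orth b (F r)\<close> are spanned by basis vectors.
  This gives the number of blocks in the first part. It also shows that the levels, the involution and
  the Gram matrix are determined by the invariants, up to a bijection of bases, and the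
  linear extension of such a bijection is an equivalence.
\<close>

section \<open>Dimensions of quotient spaces\<close>

context finite_dimensional_vector_space
begin

lemma subspace_set_plus:
  assumes "subspace U" and "subspace W"
  shows "subspace (U + W)"
proof -
  have "U + W = {x + y |x y. x \<in> U \<and> y \<in> W}"
    by (auto simp: set_plus_def)
  then show ?thesis
    using subspace_sums[OF assms] by simp
qed

lemma span_Un_set_plus: "span (S \<union> T) = span S + span T"
  by (auto simp: span_Un set_plus_def)

lemma coset_add:
  assumes "subspace W"
  shows "(u +o W) + (v +o W) = (u + v) +o W"
proof -
  have "W + W = W"
    using assms subspace_0[OF assms] subspace_add[OF assms]
    by (auto simp: set_plus_def) (metis add_0)
  then show ?thesis
    by (metis add.assoc add.commute set_plus_rearrange set_plus_rearrange2)
qed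

lemma coset_smult:
  assumes "subspace W"
  shows "scale c ` (v +o W) + W = (scale c v) +o W"
proof -
  have "scale c ` (v +o W) + W \<subseteq> (scale c v) +o W"
    using subspace_add[OF assms] subspace_scale[OF assms]
    by (fastforce simp: set_plus_def elt_set_plus_def scale_right_distrib add.assoc)
  moreover have "(scale c v) +o W \<subseteq> scale c ` (v +o W) + W"
  proof
    fix x assume "x \<in> (scale c v) +o W"
    then obtain w where w: "w \<in> W" "x = scale c v + w" by (auto simp: elt_set_plus_def)
    have "v \<in> v +o W"
      using subspace_0[OF assms] by (force simp: elt_set_plus_def)
    then have "scale c v \<in> scale c ` (v +o W)" by (rule imageI)
    then show "x \<in> scale c ` (v +o W) + W"
      using w by (simp add: set_plus_intro)
  qed
  ultimately show ?thesis by blast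
qed

lemma coset_eq_iff:
  assumes "subspace W"
  shows "u +o W = v +o W \<longleftrightarrow> u - v \<in> W"
proof
  assume "u +o W = v +o W"
  then have "u \<in> v +o W"
    using subspace_0[OF assms] by (metis add.right_neutral set_plus_intro2)
  then show "u - v \<in> W" by (auto simp: elt_set_plus_def)
next
  assume d: "u - v \<in> W"
  have sub: "x +o W \<subseteq> y +o W" if "x - y \<in> W" for x y
  proof
    fix z assume "z \<in> x +o W"
    then obtain w where "w \<in> W" "z = x + w" by (auto simp: elt_set_plus_def)
    then have "z = y + ((x - y) + w)" "(x - y) + w \<in> W"
      using subspace_add[OF assms that] by auto
    then show "z \<in> y +o W" unfolding elt_set_plus_def by blast
  qed
  have "v - u \<in> W" using subspace_neg[OF assms d] by simp
  with d sub show "u +o W = v +o W" by blast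
qed

lemma vectorspace_quotient_space:
  assumes U: "subspace U" and W: "subspace W"
  shows "vectorspace class_ring (quotient_space scale U W)"
proof -
  let ?q = "\<lambda>v. v +o W"
  note add = coset_add[OF W] and smult = coset_smult[OF W]
  have zero: "W = ?q 0" by (simp add: elt_set_plus_def)
  have "abelian_group (quotient_space scale U W)"
  proof (rule abelian_groupI)
    show "\<zero>\<^bsub>quotient_space scale U W\<^esub> \<in> carrier (quotient_space scale U W)"
      using image_eqI[where f = ?q and x = 0, OF zero subspace_0[OF U]]
      by (simp add: quotient_space_def)
  next
    fix x assume "x \<in> carrier (quotient_space scale U W)"
    then obtain v where v: "v \<in> U" "x = ?q v" by (auto simp: quotient_space_def)
    have "?q (- v) + x = W" using v add[of "- v" v] zero by simp
    then show "\<exists>y\<in>carrier (quotient_space scale U W).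
        y \<oplus>\<^bsub>quotient_space scale U W\<^esub> x = \<zero>\<^bsub>quotient_space scale U W\<^esub>"
      using v subspace_neg[OF U] by (auto simp: quotient_space_def)
  next
    fix x assume "x \<in> carrier (quotient_space scale U W)"
    then obtain v where v: "v \<in> U" "x = ?q v" by (auto simp: quotient_space_def)
    then show "\<zero>\<^bsub>quotient_space scale U W\<^esub> \<oplus>\<^bsub>quotient_space scale U W\<^esub> x = x"
      using add[of 0 v] zero by (simp add: quotient_space_def)
  qed (auto simp: quotient_space_def add add_ac subspace_add[OF U])
  moreover have "module_axioms class_ring (quotient_space scale U W)"
  proof unfold_locales
    fix x assume "x \<in> carrier (quotient_space scale U W)"
    then obtain v where v: "v \<in> U" "x = ?q v" by (auto simp: quotient_space_def)
    then show "\<one>\<^bsub>class_ring\<^esub> \<odot>\<^bsub>quotient_space scale U W\<^esub> x = x"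
      using smult[of 1 v] by (simp add: quotient_space_def class_ring_simps)
  qed (auto simp: quotient_space_def class_ring_simps smult add subspace_scale[OF U]
        simp flip: scale_left_distrib scale_right_distrib)
  ultimately show ?thesis
    unfolding vectorspace_def module_def
    using class_field class_cring.cring_axioms by blast
qed

text \<open>A coset space is spanned by the cosets of a family exactly when the family spans the large
  space together with the small one; so the least size of a generating set is the difference of
  the dimensions.\<close>

lemma dim_quotient_space_subset:
  assumes U: "subspace U" and W: "subspace W" and WU: "W \<subseteq> U"
  shows "vectorspace.dim class_ring (quotient_space scale U W) = dim U - dim W"
proof -
  let ?Q = "quotient_space scale U W"
  let ?q = "\<lambda>v. v +o W"
  interpret Q: vectorspace class_ring ?Q
    by (rule vectorspace_quotient_space[OF U W])
  define s where "s X = (SOME v. v \<in> U \<and> ?q v = X)" for X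
  have s: "s X \<in> U" "?q (s X) = X" if "X \<in> carrier ?Q" for X
  proof -
    have "\<exists>v. v \<in> U \<and> ?q v = X" using that by (auto simp: quotient_space_def)
    from someI_ex[OF this] show "s X \<in> U" "?q (s X) = X" by (auto simp: s_def)
  qed
  have lincomb: "Q.lincomb a A = ?q (\<Sum>X\<in>A. scale (a X) (s X))"
    if "finite A" "A \<subseteq> carrier ?Q" for a A
    using that
  proof (induction A)
    case empty
    show ?case by (simp add: Q.lincomb_def) (simp add: quotient_space_def elt_set_plus_def)
  next
    case (insert X A)
    have "Q.lincomb a (insert X A) = a X \<odot>\<^bsub>?Q\<^esub> X \<oplus>\<^bsub>?Q\<^esub> Q.lincomb a A"
      using insert by (intro Q.lincomb_insert2[unfolded Un_insert_right Un_empty_right])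
        (auto simp: class_ring_simps)
    also have "a X \<odot>\<^bsub>?Q\<^esub> X = ?q (scale (a X) (s X))"
      using s[of X] insert.prems coset_smult[OF W, of "a X" "s X"]
      by (simp add: quotient_space_def)
    also have "Q.lincomb a A = ?q (\<Sum>X\<in>A. scale (a X) (s X))"
      using insert by simp
    finally show ?case
      using insert coset_add[OF W] by (simp add: quotient_space_def)
  qed
  have lower: "dim U \<le> card A + dim W"
    if A: "finite A" "A \<subseteq> carrier ?Q" "Q.gen_set A" for A
  proof -
    obtain C where C: "C \<subseteq> W" "independent C" "W \<subseteq> span C" "card C = dim W"
      by (rule basis_exists)
    have "U \<subseteq> span (s ` A \<union> C)"
    proof
      fix u assume u: "u \<in> U"
      then have "?q u \<in> Q.span A" using A by (auto simp: quotient_space_def)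
      then obtain a where "?q u = Q.lincomb a A"
        using Q.finite_span[OF A(1,2)] by auto
      then have "u - (\<Sum>X\<in>A. scale (a X) (s X)) \<in> span C"
        using lincomb[OF A(1,2)] coset_eq_iff[OF W] C by auto
      then have "u - (\<Sum>X\<in>A. scale (a X) (s X)) \<in> span (s ` A \<union> C)"
        using span_mono[of C "s ` A \<union> C"] by blast
      moreover have "(\<Sum>X\<in>A. scale (a X) (s X)) \<in> span (s ` A \<union> C)"
        by (intro span_sum span_scale span_base) auto
      ultimately show "u \<in> span (s ` A \<union> C)"
        by (metis diff_add_cancel span_add)
    qed
    then have "dim U \<le> card (s ` A \<union> C)"
      using A finiteI_independent[OF C(2)] by (intro dim_le_card) auto
    also have "\<dots> \<le> card A + card C"
      by (metis A(1) add.commute add_le_mono1 card_Un_le card_image_le le_trans nat_add_left_cancel_le)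
    finally show ?thesis using C by simp
  qed
  have "\<exists>A. finite A \<and> card A \<le> dim U - dim W \<and> A \<subseteq> carrier ?Q \<and> Q.gen_set A"
  proof -
    obtain C where C: "C \<subseteq> W" "independent C" "W \<subseteq> span C" "card C = dim W"
      by (rule basis_exists)
    obtain D where D: "C \<subseteq> D" "D \<subseteq> U" "independent D" "U \<subseteq> span D"
      using maximal_independent_subset_extend[of C U] C WU by blast
    have cardD: "card D = dim U" and finD: "finite D"
      using D by (auto simp: basis_card_eq_dim finiteI_independent)
    let ?A = "?q ` (D - C)"
    have sub: "?A \<subseteq> carrier ?Q" using D by (auto simp: quotient_space_def)
    have "?q u \<in> Q.span ?A" if u: "u \<in> U" for u
    proof -
      have "u \<in> span ((D - C) \<union> C)" using u D by (auto simp: Un_absorb2)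
      then obtain d c where dc: "u = d + c" "d \<in> span (D - C)" "c \<in> span C"
        unfolding span_Un by blast
      have c: "c \<in> W" using dc C by (meson W span_minimal subsetD)
      have "?q x \<in> Q.span ?A" if "x \<in> span (D - C)" for x
        using that
      proof (induction rule: span_induct_alt)
        case base
        have "?q 0 = \<zero>\<^bsub>?Q\<^esub>" by (simp add: quotient_space_def elt_set_plus_def)
        then show ?case using Q.span_zero by simp
      next
        case (step k x y)
        have y: "?q y \<in> Q.span ?A" using step by simp
        have x: "?q x \<in> Q.span ?A"
          using Q.span_mem[OF sub, of "?q x"] step by auto
        have sm: "submodule class_ring (Q.span ?A) ?Q"
          using sub by (rule Q.span_is_submodule)
        have "k \<odot>\<^bsub>?Q\<^esub> ?q x \<oplus>\<^bsub>?Q\<^esub> ?q y \<in> Q.span ?A"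
          using submodule.smult_closed[OF sm, of k "?q x"] x y Q.span_add1[OF sub]
          by (auto simp: class_ring_simps)
        then show ?case
          by (simp add: quotient_space_def coset_add[OF W] coset_smult[OF W])
      qed
      moreover have "?q u = ?q d"
        using coset_eq_iff[OF W] dc c by simp
      ultimately show ?thesis using dc by simp
    qed
    then have "carrier ?Q \<subseteq> Q.span ?A" by (auto simp: quotient_space_def)
    moreover have "Q.span ?A \<subseteq> carrier ?Q"
      using Q.span_closed[OF sub] by blast
    moreover have "card ?A \<le> dim U - dim W"
      using card_image_le[of "D - C" ?q] finD card_Diff_subset[of C D] D C cardD
        finite_subset[OF D(1) finD] by simp
    ultimately show ?thesis using sub finD by (intro exI[of _ ?A]) auto
  qed
  then obtain A where A: "finite A" "card A \<le> dim U - dim W" "A \<subseteq> carrier ?Q" "Q.gen_set A"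
    by blast
  show ?thesis
    unfolding Q.dim_def
  proof (rule Least_equality)
    show "\<exists>A. finite A \<and> card A = dim U - dim W \<and> A \<subseteq> carrier ?Q \<and> Q.gen_set A"
      using A lower[OF A(1,3,4)] by (intro exI[of _ A]) linarith
  qed (use lower in force)
qed

text \<open>The cosets of \<open>W\<close> that meet \<open>U\<close> depend on \<open>U + W\<close> only. The subspace of isotropic classes is of
  this form, with \<open>W\<close> not necessarily contained in \<open>U\<close>.\<close>

lemma dim_quotient_space:
  assumes U: "subspace U" and W: "subspace W"
  shows "vectorspace.dim class_ring (quotient_space scale U W) = dim (U + W) - dim W"
proof -
  have "(\<lambda>v. v +o W) ` (U + W) = (\<lambda>v. v +o W) ` U"
  proof -
    have "(u + w) +o W = u +o W" if "w \<in> W" for u w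
      using that by (simp add: coset_eq_iff[OF W])
    moreover have "u \<in> U + W" if "u \<in> U" for u
      using that subspace_0[OF W] by (metis add.right_neutral set_plus_intro)
    ultimately show ?thesis by (fastforce simp: set_plus_def image_iff)
  qed
  then have "quotient_space scale U W = quotient_space scale (U + W) W"
    by (simp add: quotient_space_def)
  moreover have "W \<subseteq> U + W"
    using subspace_0[OF U] by (force simp: set_plus_def)
  ultimately show ?thesis
    using dim_quotient_space_subset[OF subspace_set_plus[OF U W] W] by simp
qed

end

section \<open>Orthogonal summands compatible with the flag\<close>

context flagged_space
begin

text \<open>Spaces of finite dimension come as a locale with a basis as parameter; any basis serves.\<close>

definition some_basis :: "'v set" where
  "some_basis = (SOME B. finite B \<and> independent B \<and> span B = UNIV)"

lemma some_basis: "finite some_basis" "independent some_basis" "span some_basis = UNIV"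
proof -
  obtain B where B: "finite B" "span B = UNIV" using finite_dimensional by blast
  obtain C where "C \<subseteq> B" "independent C" "span C = span B"
    using maximal_independent_subset[of B] span_mono span_minimal
    by (metis span_eq span_superset subset_trans)
  then have "\<exists>B. finite B \<and> independent B \<and> span B = UNIV"
    using B finite_subset by blast
  from someI_ex[OF this]
  show "finite some_basis" "independent some_basis" "span some_basis = UNIV"
    by (simp_all add: some_basis_def)
qed

sublocale finite_dimensional_vector_space scale some_basis
  by unfold_locales (fact some_basis)+

lemma
  shows form_add_left: "b (x + y) z = b x z + b y z"
    and form_scale_left: "b (scale c x) z = c * b x z"
    and form_add_right: "b z (x + y) = b z x + b z y"
    and form_scale_right: "b z (scale c x) = c * b z x"
  using linear_left[of z] linear_right[of z]
  by (simp_all add: Vector_Spaces.linear_iff)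

lemma
  shows form_zero_left [simp]: "b 0 x = 0"
    and form_zero_right [simp]: "b x 0 = 0"
  using form_scale_left[of 0 0 x] form_scale_right[of x 0 0] by simp_all

lemma
  shows form_diff_left: "b (x - y) z = b x z - b y z"
    and form_diff_right: "b z (x - y) = b z x - b z y"
  using form_add_left[of "x - y" y z] form_add_right[of z "x - y" y] by simp_all

lemma form_sum_left: "b (sum g S) z = (\<Sum>i\<in>S. b (g i) z)"
  by (induction S rule: infinite_finite_induct) (auto simp: form_add_left)

lemmas form_simps =
  form_add_left form_scale_left form_add_right form_scale_right
  form_diff_left form_diff_right form_sum_left

lemma flag_le: "q \<le> r \<Longrightarrow> F q \<subseteq> F r"
  using flag_mono by (rule lift_Suc_mono_le)

lemma flag_less: "j < q \<Longrightarrow> v \<in> F j \<Longrightarrow> v \<in> F (q - 1)"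
  using flag_le[of j "q - 1"] by fastforce

lemma flag_whole:
  obtains N where "F N = UNIV"
  using flag_exhausts by blast

lemma subspace_orth: "subspace (orth b L)"
  by (auto simp: orth_def subspace_def form_simps)

lemma orth_antimono: "K \<subseteq> L \<Longrightarrow> orth b L \<subseteq> orth b K"
  by (auto simp: orth_def)

lemma orthD: "x \<in> orth b L \<Longrightarrow> y \<in> L \<Longrightarrow> b x y = 0" "x \<in> orth b L \<Longrightarrow> y \<in> L \<Longrightarrow> b y x = 0"
  using symmetric by (auto simp: orth_def)

lemma orth_flag_le: "q \<le> r \<Longrightarrow> x \<in> orth b (F r) \<Longrightarrow> x \<in> orth b (F q)"
  using orth_antimono[OF flag_le] by blast

lemma orth_UNIV: "orth b UNIV = {0}"
  using nondegenerate by (auto simp: orth_def)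

lemma orth_zero: "orth b {0} = UNIV"
  by (simp add: orth_def)

text \<open>Reading off the values of \<open>b a\<close> on a basis is injective in \<open>a\<close>, by nondegeneracy, hence
  also surjective by finite dimension: the values may be prescribed.\<close>

lemma form_prescribed_on_basis:
  assumes B: "finite B" "independent B" "span B = UNIV"
  obtains a where "\<And>x. x \<in> B \<Longrightarrow> b a x = g x"
proof -
  define T where "T a = (\<Sum>x\<in>B. scale (b a x) x)" for a
  have "Vector_Spaces.linear scale scale T"
    unfolding Vector_Spaces.linear_iff
    by (auto simp: T_def form_simps scale_left_distrib sum.distrib scale_sum_right vector_space_axioms)
  moreover have "inj T"
  proof (rule injI)
    fix a c assume "T a = T c"
    then have "(\<Sum>x\<in>B. scale (b (a - c) x) x) = 0"
      by (simp add: T_def form_simps scale_left_diff_distrib sum_subtractf)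
    then have zero: "b (a - c) x = 0" if "x \<in> B" for x
      using independentD[OF B(2,1) subset_refl _ that, of "b (a - c)"] by simp
    have "B \<subseteq> orth b {a - c}" using zero symmetric by (auto simp: orth_def)
    then have "span B \<subseteq> orth b {a - c}" by (rule span_minimal) (rule subspace_orth)
    then have "a - c \<in> orth b UNIV" using B symmetric by (auto simp: orth_def)
    then show "a = c" by (simp add: orth_UNIV)
  qed
  ultimately have "surj T" by (rule linear_inj_imp_surj)
  then obtain a where a: "T a = (\<Sum>x\<in>B. scale (g x) x)" by (metis surjD)
  then have "(\<Sum>x\<in>B. scale (b a x - g x) x) = 0"
    by (simp add: T_def scale_left_diff_distrib sum_subtractf)
  then have "b a x - g x = 0" if "x \<in> B" for x
    using independentD[OF B(2,1) subset_refl _ that, of "\<lambda>x. b a x - g x"] by simp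
  then have "b a x = g x" if "x \<in> B" for x using that by simp
  then show ?thesis by (rule that)
qed

text \<open>A vector outside \<open>L\<close> is separated from \<open>L\<close> by a linear functional, and every linear functional
  is \<open>b a\<close> for some \<open>a\<close>.\<close>

lemma orth_orth:
  assumes L: "subspace L"
  shows "orth b (orth b L) = L"
proof
  show "L \<subseteq> orth b (orth b L)" by (auto simp: orth_def symmetric)
  show "orth b (orth b L) \<subseteq> L"
  proof
    fix x assume x: "x \<in> orth b (orth b L)"
    show "x \<in> L"
    proof (rule ccontr)
      assume xL: "x \<notin> L"
      obtain C where C: "C \<subseteq> L" "independent C" "L \<subseteq> span C"
        by (rule basis_exists)
      have "x \<notin> span C" using xL C L span_minimal by blast
      then have "independent (insert x C)" using C by (simp add: independent_insertI)
      then obtain D where D: "insert x C \<subseteq> D" "independent D" "UNIV \<subseteq> span D"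
        using maximal_independent_subset_extend[of "insert x C" UNIV] by auto
      obtain a where a: "\<And>y. y \<in> D \<Longrightarrow> b a y = (if y = x then 1 else 0)"
        by (rule form_prescribed_on_basis[of D "\<lambda>y. if y = x then 1 else 0"])
          (use D finiteI_independent in auto)
      have "C \<subseteq> orth b {a}"
        using a D \<open>x \<notin> span C\<close> span_base symmetric by (auto simp: orth_def subset_iff)
      then have "L \<subseteq> orth b {a}"
        using C(3) span_minimal[OF _ subspace_orth] by blast
      then have "a \<in> orth b L" using symmetric by (auto simp: orth_def)
      then have "b a x = 0" using x orthD by blast
      then show False using a[of x] D by simp
    qed
  qed
qed

lemma orth_Int:
  assumes L: "subspace L" and M: "subspace M"
  shows "orth b (L \<inter> M) = orth b L + orth b M"
proof -
  have "orth b (orth b L + orth b M) \<subseteq> L \<inter> M"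
  proof -
    have "orth b L \<subseteq> orth b L + orth b M" "orth b M \<subseteq> orth b L + orth b M"
      using subspace_0[OF subspace_orth] by (force simp: set_plus_def)+
    then show ?thesis using orth_antimono orth_orth[OF L] orth_orth[OF M] by blast
  qed
  then have "orth b (L \<inter> M) \<subseteq> orth b (orth b (orth b L + orth b M))"
    by (rule orth_antimono)
  also have "\<dots> = orth b L + orth b M"
    by (intro orth_orth subspace_set_plus subspace_orth)
  finally have "orth b (L \<inter> M) \<subseteq> orth b L + orth b M" .
  moreover have "orth b L + orth b M \<subseteq> orth b (L \<inter> M)"
  proof
    fix x assume "x \<in> orth b L + orth b M"
    then obtain u w where "x = u + w" "u \<in> orth b L" "w \<in> orth b M" by (rule set_plus_elim)
    moreover have "orth b L \<subseteq> orth b (L \<inter> M)" "orth b M \<subseteq> orth b (L \<inter> M)"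
      by (simp_all add: orth_antimono)
    ultimately show "x \<in> orth b (L \<inter> M)" using subspace_add[OF subspace_orth] by blast
  qed
  ultimately show ?thesis by blast
qed

text \<open>A subspace \<open>X\<close> for which the triple is the orthogonal sum of its restrictions to \<open>X\<close> and \<open>orth b X\<close>,
  that is, \<open>F q\<close> is the sum of its intersections with \<open>X\<close> and \<open>orth b X\<close> for every \<open>q\<close>. As some \<open>F q\<close> is
  the whole space, the form is then nondegenerate on \<open>X\<close>.\<close>

definition flag_summand :: "'v set \<Rightarrow> bool" where
  "flag_summand X \<longleftrightarrow>
     subspace X \<and> (\<forall>q. \<forall>v\<in>F q. \<exists>x\<in>X \<inter> F q. v - x \<in> orth b X)"

text \<open>Numerator and denominator of \<open>\<Phi>\<^sub>q\<^sub>r\<close> for the restriction of the triple to a flag summand \<open>X\<close>.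
  Orthogonality to all of \<open>F r\<close> is the same, for a vector of \<open>X\<close>, as orthogonality to
  \<open>X \<inter> F r\<close>, since the rest of \<open>F r\<close> can be taken in \<open>orth b X\<close>.\<close>

definition num :: "'v set \<Rightarrow> nat \<Rightarrow> nat \<Rightarrow> 'v set" where
  "num X q r = X \<inter> F q \<inter> orth b (F (r - 1))"

definition den :: "'v set \<Rightarrow> nat \<Rightarrow> nat \<Rightarrow> 'v set" where
  "den X q r = (X \<inter> F q \<inter> orth b (F r)) + (X \<inter> F (q - 1) \<inter> orth b (F (r - 1)))"

lemma num_UNIV: "num UNIV q r = Phi_num b F q r"
  by (simp add: num_def Phi_num_def)

lemma den_UNIV: "den UNIV q r = Phi_den b F q r"
  by (simp add: den_def Phi_den_def)

lemma flag_summand_UNIV: "flag_summand UNIV"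
  unfolding flag_summand_def
proof (intro conjI allI ballI subspace_UNIV)
  show "\<exists>x\<in>UNIV \<inter> F q. v - x \<in> orth b UNIV" if "v \<in> F q" for q v
    using that by (intro bexI[of _ v]) (auto simp: orth_def)
qed

lemma flag_summand_subspace: "flag_summand X \<Longrightarrow> subspace X"
  by (simp add: flag_summand_def)

lemma flag_summand_component:
  assumes "flag_summand X" and "v \<in> F q"
  obtains x where "x \<in> X" "x \<in> F q" "v - x \<in> orth b X"
  using assms unfolding flag_summand_def by blast

lemma subspace_num: "subspace X \<Longrightarrow> subspace (num X q r)"
  by (simp add: num_def subspace_inter flag_subspace subspace_orth)

lemma subspace_den: "subspace X \<Longrightarrow> subspace (den X q r)"
  by (simp add: den_def subspace_inter subspace_set_plus flag_subspace subspace_orth)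

lemma den_subset_num: "subspace X \<Longrightarrow> den X q r \<subseteq> num X q r"
  unfolding den_def
proof
  fix x assume X: "subspace X"
    and "x \<in> (X \<inter> F q \<inter> orth b (F r)) + (X \<inter> F (q - 1) \<inter> orth b (F (r - 1)))"
  then obtain u w where uw: "x = u + w" "u \<in> X \<inter> F q \<inter> orth b (F r)"
    "w \<in> X \<inter> F (q - 1) \<inter> orth b (F (r - 1))"
    by (auto simp: set_plus_def)
  have "u \<in> num X q r" "w \<in> num X q r"
    using uw orth_flag_le[of "r - 1" r] flag_le[of "q - 1" q] by (auto simp: num_def)
  then show "x \<in> num X q r" using uw subspace_add[OF subspace_num[OF X]] by simp
qed

lemma den_subset: "subspace X \<Longrightarrow> den X q r \<subseteq> X"
  using den_subset_num[of X q r] by (auto simp: num_def)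

lemma num_mono: "X \<subseteq> Y \<Longrightarrow> num X q r \<subseteq> num Y q r"
  by (auto simp: num_def)

lemma den_mono: "X \<subseteq> Y \<Longrightarrow> den X q r \<subseteq> den Y q r"
  unfolding den_def by (intro set_plus_mono2) auto

lemma den_orth_num: "w \<in> den X q r \<Longrightarrow> e \<in> num Y r q \<Longrightarrow> b w e = 0"
proof -
  assume w: "w \<in> den X q r" and e: "e \<in> num Y r q"
  obtain w1 w2 where ww: "w = w1 + w2" "w1 \<in> X \<inter> F q \<inter> orth b (F r)"
    "w2 \<in> X \<inter> F (q - 1) \<inter> orth b (F (r - 1))"
    using w by (auto simp: set_plus_def den_def)
  then have "b w1 e = 0" "b w2 e = 0" using e by (auto simp: num_def orthD)
  then show "b w e = 0" by (simp add: ww form_simps)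
qed

text \<open>The component in \<open>X\<close> for the least \<open>q\<close> with \<open>v \<in> F q\<close> serves all \<open>q\<close>, because the flag is a chain.
  It inherits orthogonality to \<open>F q\<close> because \<open>F q\<close> splits as well.\<close>

lemma flag_summand_projection:
  assumes X: "flag_summand X"
  obtains x where "x \<in> X" "v - x \<in> orth b X"
    "\<And>q. v \<in> F q \<Longrightarrow> x \<in> F q" "\<And>q. v \<in> orth b (F q) \<Longrightarrow> x \<in> orth b (F q)"
proof -
  have ex: "\<exists>q. v \<in> F q" by (metis UNIV_I flag_whole)
  define l where "l = (LEAST q. v \<in> F q)"
  have l: "v \<in> F l" "\<And>q. v \<in> F q \<Longrightarrow> l \<le> q"
    unfolding l_def using ex by (auto intro: LeastI_ex Least_le)
  obtain x where x: "x \<in> X" "x \<in> F l" "v - x \<in> orth b X"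
    by (rule flag_summand_component[OF X l(1)])
  show ?thesis
  proof (rule that[OF x(1,3)])
    show "x \<in> F q" if "v \<in> F q" for q using x flag_le[OF l(2)[OF that]] by blast
    show "x \<in> orth b (F q)" if v: "v \<in> orth b (F q)" for q
      unfolding orth_def
    proof (intro CollectI ballI)
      fix y assume y: "y \<in> F q"
      then obtain z where z: "z \<in> X" "z \<in> F q" "y - z \<in> orth b X"
        by (rule flag_summand_component[OF X])
      have "b x (y - z) = 0" "b (v - x) z = 0" "b v z = 0"
        using x z v orthD by blast+
      then show "b x y = 0" by (simp add: form_simps)
    qed
  qed
qed

lemma flag_summand_Int_orth:
  assumes H: "flag_summand H" and x: "x \<in> H" "x \<in> orth b H"
  shows "x = 0"
proof -
  have "b x v = 0" for v
  proof -
    obtain h where "h \<in> H" "v - h \<in> orth b H"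
      by (rule flag_summand_projection[OF H, of v]) blast
    then have "b x (v - h) = 0" "b x h = 0" using x orthD by blast+
    then show ?thesis by (simp add: form_simps)
  qed
  then show ?thesis using nondegenerate by blast
qed

lemma flag_summand_decomposition:
  assumes X: "subspace X" and H: "flag_summand H" "H \<subseteq> X" and v: "v \<in> X"
  obtains h x where "v = h + x" "h \<in> H" "x \<in> X \<inter> orth b H"
    "\<And>q. v \<in> F q \<Longrightarrow> h \<in> F q \<and> x \<in> F q"
    "\<And>q. v \<in> orth b (F q) \<Longrightarrow> h \<in> orth b (F q) \<and> x \<in> orth b (F q)"
proof -
  obtain h where h: "h \<in> H" "v - h \<in> orth b H"
    "\<And>q. v \<in> F q \<Longrightarrow> h \<in> F q" "\<And>q. v \<in> orth b (F q) \<Longrightarrow> h \<in> orth b (F q)"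
    by (rule flag_summand_projection[OF H(1), of v]) blast
  show ?thesis
  proof (rule that[of h "v - h"])
    show "v - h \<in> X \<inter> orth b H" using h H v subspace_diff[OF X] by blast
    show "h \<in> F q \<and> v - h \<in> F q" if "v \<in> F q" for q
      using h(3) that subspace_diff[OF flag_subspace] by blast
    show "h \<in> orth b (F q) \<and> v - h \<in> orth b (F q)" if "v \<in> orth b (F q)" for q
      using h(4) that subspace_diff[OF subspace_orth] by blast
  qed (use h in auto)
qed

lemma flag_summand_complement:
  assumes X: "flag_summand X" and H: "flag_summand H" "H \<subseteq> X"
  shows "flag_summand (X \<inter> orth b H)"
  unfolding flag_summand_def
proof (intro conjI allI ballI)
  show "subspace (X \<inter> orth b H)"
    using X by (simp add: flag_summand_subspace subspace_inter subspace_orth)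
  fix q v assume v: "v \<in> F q"
  obtain x where x: "x \<in> X" "x \<in> F q" "v - x \<in> orth b X"
    by (rule flag_summand_component[OF X v])
  obtain h y where y: "x = h + y" "h \<in> H" "y \<in> X \<inter> orth b H" "y \<in> F q"
    using flag_summand_decomposition[OF flag_summand_subspace[OF X] H x(1)] x(2) by metis
  have "(v - x) + h \<in> orth b (X \<inter> orth b H)"
  proof (rule subspace_add[OF subspace_orth])
    show "v - x \<in> orth b (X \<inter> orth b H)" using x orth_antimono by blast
    show "h \<in> orth b (X \<inter> orth b H)" using y by (auto simp: orth_def symmetric)
  qed
  then have "v - y \<in> orth b (X \<inter> orth b H)" using y(1) by (simp add: algebra_simps)
  then show "\<exists>x\<in>(X \<inter> orth b H) \<inter> F q. v - x \<in> orth b (X \<inter> orth b H)" using y by blast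
qed

lemma num_decomposition:
  assumes X: "subspace X" and H: "flag_summand H" "H \<subseteq> X" and v: "v \<in> num X q r"
  obtains h x where "v = h + x" "h \<in> num H q r" "x \<in> num (X \<inter> orth b H) q r"
proof -
  obtain h x where hx: "v = h + x" "h \<in> H" "x \<in> X \<inter> orth b H"
    "\<And>q. v \<in> F q \<Longrightarrow> h \<in> F q \<and> x \<in> F q"
    "\<And>q. v \<in> orth b (F q) \<Longrightarrow> h \<in> orth b (F q) \<and> x \<in> orth b (F q)"
    using flag_summand_decomposition[OF X H, of v] v by (auto simp: num_def)
  show ?thesis by (rule that[OF hx(1)]) (use hx v in \<open>auto simp: num_def\<close>)
qed

lemma den_decomposition:
  assumes X: "subspace X" and H: "flag_summand H" "H \<subseteq> X" and v: "v \<in> den X q r"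
  obtains h x where "v = h + x" "h \<in> den H q r" "x \<in> den (X \<inter> orth b H) q r"
proof -
  obtain v1 v2 where vv: "v = v1 + v2" "v1 \<in> X \<inter> F q \<inter> orth b (F r)"
    "v2 \<in> X \<inter> F (q - 1) \<inter> orth b (F (r - 1))"
    using v by (auto simp: set_plus_def den_def)
  obtain h1 x1 where 1: "v1 = h1 + x1" "h1 \<in> H" "x1 \<in> X \<inter> orth b H"
    "\<And>q. v1 \<in> F q \<Longrightarrow> h1 \<in> F q \<and> x1 \<in> F q"
    "\<And>q. v1 \<in> orth b (F q) \<Longrightarrow> h1 \<in> orth b (F q) \<and> x1 \<in> orth b (F q)"
    using flag_summand_decomposition[OF X H, of v1] vv by auto
  obtain h2 x2 where 2: "v2 = h2 + x2" "h2 \<in> H" "x2 \<in> X \<inter> orth b H"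
    "\<And>q. v2 \<in> F q \<Longrightarrow> h2 \<in> F q \<and> x2 \<in> F q"
    "\<And>q. v2 \<in> orth b (F q) \<Longrightarrow> h2 \<in> orth b (F q) \<and> x2 \<in> orth b (F q)"
    using flag_summand_decomposition[OF X H, of v2] vv by auto
  show ?thesis
  proof (rule that[of "h1 + h2" "x1 + x2"])
    show "v = h1 + h2 + (x1 + x2)" using 1 2 vv by (simp add: add_ac)
    show "h1 + h2 \<in> den H q r" "x1 + x2 \<in> den (X \<inter> orth b H) q r"
      unfolding den_def using 1 2 vv by (auto intro!: set_plus_intro)
  qed
qed

lemma den_complement:
  assumes X: "subspace X" and H: "flag_summand H" "H \<subseteq> X"
    and v: "v \<in> den X q r" "v \<in> orth b H"
  shows "v \<in> den (X \<inter> orth b H) q r"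
proof -
  obtain h x where hx: "v = h + x" "h \<in> den H q r" "x \<in> den (X \<inter> orth b H) q r"
    by (rule den_decomposition[OF X H v(1)])
  have "h \<in> H" "x \<in> orth b H"
    using hx den_subset[OF flag_summand_subspace[OF H(1)]]
      den_subset[OF subspace_inter[OF X subspace_orth]] by blast+
  moreover have "h \<in> orth b H"
    using hx(1) v(2) \<open>x \<in> orth b H\<close> subspace_diff[OF subspace_orth, of v H x] by simp
  ultimately have "h = 0" using flag_summand_Int_orth[OF H(1)] by blast
  then show ?thesis using hx by simp
qed

text \<open>The form pairs \<open>\<Phi>\<^sub>q\<^sub>r\<close> with \<open>\<Phi>\<^sub>r\<^sub>q\<close>, and this pairing is nondegenerate: the orthogonal complement of
  \<open>F r \<inter> orth b (F (q - 1))\<close> is \<open>orth b (F r) + F (q - 1)\<close>, and the modular law turns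
  membership in that sum into membership in the denominator.\<close>

lemma num_den_duality:
  assumes X: "flag_summand X" and x: "x \<in> num X q r" and "x \<notin> den X q r"
  obtains e where "e \<in> num X r q" "b e x = 1"
proof -
  have "\<exists>e\<in>num X r q. b e x \<noteq> 0"
  proof (rule ccontr)
    assume neg: "\<not> ?thesis"
    have "x \<in> orth b (F r \<inter> orth b (F (q - 1)))"
      unfolding orth_def
    proof (intro CollectI ballI)
      fix v assume "v \<in> F r \<inter> {v. \<forall>l\<in>F (q - 1). b v l = 0}"
      then have v: "v \<in> F r" "v \<in> orth b (F (q - 1))" by (auto simp: orth_def)
      obtain y where "y \<in> X" "v - y \<in> orth b X"
        "\<And>q. v \<in> F q \<Longrightarrow> y \<in> F q" "\<And>q. v \<in> orth b (F q) \<Longrightarrow> y \<in> orth b (F q)"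
        by (rule flag_summand_projection[OF X, of v]) blast
      with v have y: "v - y \<in> orth b X" "y \<in> num X r q" by (auto simp: num_def)
      have "b x (v - y) = 0" using x y(1) orthD(2)[OF y(1)] by (simp add: num_def)
      moreover have "b x y = 0" using neg y(2) symmetric[of x y] by metis
      ultimately show "b x v = 0" by (simp add: form_simps)
    qed
    then have "x \<in> orth b (F r) + F (q - 1)"
      by (simp add: orth_Int flag_subspace subspace_orth orth_orth)
    then obtain u w where uw: "x = u + w" "u \<in> orth b (F r)" "w \<in> F (q - 1)"
      by (auto simp: set_plus_def)
    have xF: "x \<in> F q" "x \<in> orth b (F (r - 1))" "x \<in> X" using x by (auto simp: num_def)
    have "w \<in> F q" "u \<in> orth b (F (r - 1))"
      using uw flag_le[of "q - 1" q] orth_flag_le[of "r - 1" r] by auto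
    then have "u \<in> F q" "w \<in> orth b (F (r - 1))"
      using uw xF subspace_diff[OF flag_subspace, of x q w]
        subspace_diff[OF subspace_orth, of x _ u] by auto
    with uw have d: "x \<in> den UNIV q r" by (auto simp: den_def intro!: set_plus_intro)
    then obtain h y where hy: "x = h + y" "h \<in> den X q r" "y \<in> den (UNIV \<inter> orth b X) q r"
      using den_decomposition[OF subspace_UNIV X _ d] by blast
    have "h \<in> X" using hy den_subset[OF flag_summand_subspace[OF X]] by blast
    have "y \<in> orth b X"
      using hy den_subset[OF subspace_inter[OF subspace_UNIV subspace_orth]] by blast
    moreover have "y \<in> X"
      using hy(1) xF \<open>h \<in> X\<close> subspace_diff[OF flag_summand_subspace[OF X], of x h] by simp
    ultimately have "y = 0" using flag_summand_Int_orth[OF X] by blast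
    then show False using hy assms(3) by simp
  qed
  then obtain e where e: "e \<in> num X r q" "b e x \<noteq> 0" by blast
  show ?thesis
  proof (rule that[of "scale (1 / b e x) e"])
    show "scale (1 / b e x) e \<in> num X r q"
      using e subspace_scale[OF subspace_num[OF flag_summand_subspace[OF X]]] by blast
  qed (use e in \<open>simp add: form_simps\<close>)
qed

text \<open>Two classes of \<open>\<Phi>\<^sub>q\<^sub>r\<close> that are linearly independent can be given prescribed values by one element
  of \<open>\<Phi>\<^sub>r\<^sub>q\<close>; only the values \<open>1\<close> and \<open>0\<close> occur below.\<close>

lemma num_den_duality_two:
  assumes X: "flag_summand X" and f: "f \<in> num X q r" and u: "u \<in> num X q r"
    and u_den: "u \<notin> den X q r" and f_den: "\<And>c. f - scale c u \<notin> den X q r"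
  obtains e where "e \<in> num X r q" "b e f = 1" "b e u = 0"
proof -
  note sub = subspace_num[OF flag_summand_subspace[OF X]]
  obtain e1 where e1: "e1 \<in> num X r q" "b e1 u = 1"
    by (rule num_den_duality[OF X u u_den])
  \<comment> \<open>\<open>e1\<close> vanishes on \<open>f'\<close>, so correcting \<open>e2\<close> by \<open>e1\<close> does not spoil its value there\<close>
  define f' where "f' = f - scale (b e1 f) u"
  have "f' \<in> num X q r"
    unfolding f'_def by (rule subspace_diff[OF sub f subspace_scale[OF sub u]])
  then obtain e2 where e2: "e2 \<in> num X r q" "b e2 f' = 1"
    by (rule num_den_duality[OF X]) (use f_den in \<open>simp add: f'_def\<close>)
  show ?thesis
  proof (rule that[of "e2 - scale (b e2 u) e1"])
    show "e2 - scale (b e2 u) e1 \<in> num X r q"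
      using e1 e2 by (simp add: subspace_diff subspace_scale subspace_num flag_summand_subspace[OF X])
    show "b (e2 - scale (b e2 u) e1) f = 1"
      using e1 e2 by (simp add: f'_def form_simps algebra_simps)
    show "b (e2 - scale (b e2 u) e1) u = 0"
      using e1 by (simp add: form_simps)
  qed
qed

text \<open>For the least \<open>q\<close> with \<open>X \<inter> F q\<close> nonzero, and then the least \<open>r\<close> with
  \<open>X \<inter> F q \<inter> orth b (F r)\<close> zero, the denominator vanishes and the numerator does not. If \<open>q < r\<close>,
  duality exchanges the two indices.\<close>

lemma exists_num_not_subset_den:
  assumes X: "flag_summand X" and X0: "X \<noteq> {0}"
  obtains q r where "r \<le> q" "\<not> num X q r \<subseteq> den X q r"
proof -
  have subX: "subspace X" using X by (rule flag_summand_subspace)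
  obtain N where N: "F N = UNIV" by (rule flag_whole)
  have "0 \<in> X" using subX subspace_0 by blast
  then have exq: "\<exists>q. X \<inter> F q \<noteq> {0}" using N X0 by (metis inf_top_right)
  define q where "q = (LEAST q. X \<inter> F q \<noteq> {0})"
  have q: "X \<inter> F q \<noteq> {0}" and q_least: "\<And>j. j < q \<Longrightarrow> X \<inter> F j = {0}"
    unfolding q_def using exq by (metis (mono_tags, lifting) LeastI_ex) (metis (mono_tags, lifting) not_less_Least)
  have "q \<noteq> 0" using q flag_zero \<open>0 \<in> X\<close> by auto
  have zero: "0 \<in> X \<inter> F q \<inter> orth b (F j)" for j
    using \<open>0 \<in> X\<close> subspace_0[OF flag_subspace] subspace_0[OF subspace_orth] by blast
  have exr: "\<exists>r. X \<inter> F q \<inter> orth b (F r) = {0}"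
    using N orth_UNIV zero[of N] by (intro exI[of _ N]) auto
  define r where "r = (LEAST r. X \<inter> F q \<inter> orth b (F r) = {0})"
  have r: "X \<inter> F q \<inter> orth b (F r) = {0}"
    and r_least: "\<And>j. j < r \<Longrightarrow> X \<inter> F q \<inter> orth b (F j) \<noteq> {0}"
    unfolding r_def using exr by (metis (mono_tags, lifting) LeastI_ex) (metis (mono_tags, lifting) not_less_Least)
  have "r \<noteq> 0" using r q flag_zero orth_zero by auto
  obtain x where x: "x \<in> num X q r" "x \<noteq> 0"
    using r_least[of "r - 1"] \<open>r \<noteq> 0\<close> zero[of "r - 1"] by (auto simp: num_def)
  have "den X q r = {0}"
    using r q_least[of "q - 1"] \<open>q \<noteq> 0\<close> subspace_0[OF subspace_orth]
    by (auto simp: den_def set_plus_def)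
  with x have x_den: "x \<notin> den X q r" by simp
  show ?thesis
  proof (cases "r \<le> q")
    case True
    then show ?thesis using that x x_den by blast
  next
    case False
    obtain e where e: "e \<in> num X r q" "b e x = 1"
      by (rule num_den_duality[OF X x(1) x_den])
    then have "e \<notin> den X r q" using den_orth_num x(1) by force
    then show ?thesis using that[of q r] e False by auto
  qed
qed

text \<open>The orthogonal projection onto the span of \<open>e\<close> and \<open>f\<close> has coefficients computed from \<open>b v e\<close> and
  \<open>b v f\<close>. For \<open>v\<close> in an early member of the flag, the coefficient of a vector that this member
  does not contain vanishes, because \<open>e\<close> is orthogonal to \<open>F (q - 1)\<close> and \<open>f\<close> to \<open>F (r - 1)\<close>.\<close>

lemma flag_summand_pair:
  assumes f: "f \<in> num UNIV q r" and e: "e \<in> num UNIV r q"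
    and rq: "r \<le> q" and ef: "b e f = 1" and ee: "b e e = 0"
  shows "flag_summand (span {e, f})"
  unfolding flag_summand_def
proof (intro conjI allI ballI subspace_span)
  fix j v assume v: "v \<in> F j"
  have fe: "b f e = 1" using ef symmetric by metis
  define c where "c = b v f - b v e * b f f"
  define h where "h = scale (b v e) f + scale c e"
  have h: "h \<in> span {e, f}"
    unfolding h_def by (intro span_add span_scale span_base) auto
  have inF: "f \<in> F q" "e \<in> F r" using e f by (auto simp: num_def)
  have "h \<in> F j"
  proof -
    have "scale (b v e) f \<in> F j"
    proof (cases "q \<le> j")
      case True
      then show ?thesis using inF flag_le subspace_scale[OF flag_subspace] by blast
    next
      case False
      then have "v \<in> F (q - 1)" using v by (intro flag_less) auto
      then have "b v e = 0" using e orthD by (auto simp: num_def)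
      then show ?thesis using subspace_0[OF flag_subspace] by simp
    qed
    moreover have "scale c e \<in> F j"
    proof (cases "r \<le> j")
      case True
      then show ?thesis using inF flag_le subspace_scale[OF flag_subspace] by blast
    next
      case False
      then have "v \<in> F (r - 1)" "v \<in> F (q - 1)"
        using v rq by (auto intro!: flag_less simp del: One_nat_def)
      then have "b v e = 0" "b v f = 0" using e f orthD by (auto simp: num_def)
      then show ?thesis using subspace_0[OF flag_subspace] by (simp add: c_def)
    qed
    ultimately show ?thesis unfolding h_def using subspace_add[OF flag_subspace] by blast
  qed
  moreover have "v - h \<in> orth b (span {e, f})"
  proof -
    have "b (v - h) e = 0" "b (v - h) f = 0"
      using ef ee fe by (simp_all add: h_def c_def form_simps)
    then have "{e, f} \<subseteq> orth b {v - h}" by (auto simp: orth_def symmetric)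
    then have "span {e, f} \<subseteq> orth b {v - h}" by (rule span_minimal) (rule subspace_orth)
    then show ?thesis by (auto simp: orth_def symmetric)
  qed
  ultimately show "\<exists>x\<in>span {e, f} \<inter> F j. v - x \<in> orth b (span {e, f})" using h by blast
qed

lemma flag_summand_single:
  assumes f: "f \<in> num UNIV q q" and ff: "b f f = 1"
  shows "flag_summand (span {f})"
  unfolding flag_summand_def
proof (intro conjI allI ballI subspace_span)
  fix j v assume v: "v \<in> F j"
  define h where "h = scale (b v f) f"
  have h: "h \<in> span {f}"
    unfolding h_def by (intro span_scale span_base) auto
  have "h \<in> F j"
  proof (cases "q \<le> j")
    case True
    then show ?thesis
      unfolding h_def using f flag_le[of q j]
      by (intro subspace_scale[OF flag_subspace]) (auto simp: num_def)
  next
    case False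
    then have "v \<in> F (q - 1)" using v by (intro flag_less) auto
    then have "b v f = 0" using f orthD by (auto simp: num_def)
    then show ?thesis using subspace_0[OF flag_subspace] by (simp add: h_def)
  qed
  moreover have "v - h \<in> orth b (span {f})"
  proof -
    have "b (v - h) f = 0" using ff by (simp add: h_def form_simps)
    then have "{f} \<subseteq> orth b {v - h}" by (auto simp: orth_def symmetric)
    then have "span {f} \<subseteq> orth b {v - h}" by (rule span_minimal) (rule subspace_orth)
    then show ?thesis by (auto simp: orth_def symmetric)
  qed
  ultimately show "\<exists>x\<in>span {f} \<inter> F j. v - x \<in> orth b (span {f})" using h by blast
qed

end

section \<open>Normal bases\<close>

definition (in flagged_space) level :: "'v \<Rightarrow> nat" where
  "level v = (LEAST j. v \<in> F j)"

lemma (in flagged_space) mem_flag_iff: "v \<in> F j \<longleftrightarrow> level v \<le> j"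
proof
  show "v \<in> F j \<Longrightarrow> level v \<le> j" unfolding level_def by (rule Least_le)
  assume le: "level v \<le> j"
  have "\<exists>j. v \<in> F j" by (metis UNIV_I flag_whole)
  then have "v \<in> F (level v)" unfolding level_def by (rule LeastI_ex)
  then show "v \<in> F j" using flag_le[OF le] by blast
qed

lemma (in flagged_space) level_eqI:
  assumes "v \<in> F q" and "v \<notin> F (q - 1)"
  shows "level v = q"
  using assms unfolding mem_flag_iff by linarith

lemma (in flagged_space) span_pairE:
  assumes "v \<in> span {x, y}"
  obtains c d where "v = scale c x + scale d y"
proof -
  obtain c where "v - scale c x \<in> span {y}" using assms by (auto simp: span_insert)
  then obtain d where "v - scale c x = scale d y" by (auto simp: span_singleton)
  then show ?thesis using that[of c d] by (simp add: algebra_simps)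
qed

text \<open>A basis \<open>B\<close> of \<open>X\<close> adapted to the flag, in which \<open>x\<close> pairs only with its partner \<open>\<sigma> x\<close> and possibly
  with itself. The set \<open>R\<close> has one member of each pair of distinct partners, the one of higher level
  if the levels differ; a fixed point of \<open>\<sigma>\<close> is a block of size one. The predicate \<open>C\<close>, in terms of the levels of
  \<open>x\<close> and \<open>\<sigma> x\<close>, says which basis vectors are not isotropic. Everything about the Gram matrix is thus
  encoded by \<open>\<sigma>\<close>, the levels and \<open>C\<close>, which makes normal bases of different spaces comparable.\<close>

definition (in flagged_space) normal_basis ::
  "(nat \<Rightarrow> nat \<Rightarrow> bool) \<Rightarrow> 'v set \<Rightarrow> 'v set \<Rightarrow> ('v \<Rightarrow> 'v) \<Rightarrow> 'v set \<Rightarrow> bool" where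
  "normal_basis C X B \<sigma> R \<longleftrightarrow>
     finite B \<and> B \<subseteq> X \<and> (\<forall>q. X \<inter> F q \<subseteq> span (B \<inter> F q)) \<and>
     (\<forall>x\<in>B. \<sigma> x \<in> B \<and> \<sigma> (\<sigma> x) = x) \<and>
     R \<subseteq> B \<and> (\<forall>x\<in>B. \<sigma> x \<noteq> x \<longrightarrow> (\<sigma> x \<in> R \<longleftrightarrow> x \<notin> R)) \<and>
     (\<forall>x\<in>R. \<sigma> x \<noteq> x \<and> level (\<sigma> x) \<le> level x) \<and>
     (\<forall>x\<in>B. \<sigma> x = x \<longleftrightarrow> level (\<sigma> x) = level x \<and> C (level x) (level x)) \<and>
     (\<forall>x\<in>B. \<forall>y\<in>B. b x y = (if y = \<sigma> x \<or> y = x \<and> C (level x) (level (\<sigma> x)) then 1 else 0))"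

context flagged_space
begin

lemma normal_basisD:
  assumes "normal_basis C X B \<sigma> R"
  shows "finite B" and "B \<subseteq> X" and "v \<in> X \<Longrightarrow> v \<in> F q \<Longrightarrow> v \<in> span (B \<inter> F q)"
    and "x \<in> B \<Longrightarrow> \<sigma> x \<in> B" and "x \<in> B \<Longrightarrow> \<sigma> (\<sigma> x) = x"
    and "R \<subseteq> B" and "x \<in> B \<Longrightarrow> \<sigma> x \<noteq> x \<Longrightarrow> \<sigma> x \<in> R \<longleftrightarrow> x \<notin> R"
    and "x \<in> R \<Longrightarrow> \<sigma> x \<noteq> x" and "x \<in> R \<Longrightarrow> level (\<sigma> x) \<le> level x"
    and "x \<in> B \<Longrightarrow> \<sigma> x = x \<longleftrightarrow> level (\<sigma> x) = level x \<and> C (level x) (level x)"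
    and "x \<in> B \<Longrightarrow> y \<in> B \<Longrightarrow>
      b x y = (if y = \<sigma> x \<or> y = x \<and> C (level x) (level (\<sigma> x)) then 1 else 0)"
proof -
  note d = assms[unfolded normal_basis_def]
  show "finite B" "B \<subseteq> X" "R \<subseteq> B" using d by - (elim conjE, assumption)+
  have span: "\<forall>q. X \<inter> F q \<subseteq> span (B \<inter> F q)"
    and invol: "\<forall>x\<in>B. \<sigma> x \<in> B \<and> \<sigma> (\<sigma> x) = x"
    and repr: "\<forall>x\<in>B. \<sigma> x \<noteq> x \<longrightarrow> (\<sigma> x \<in> R \<longleftrightarrow> x \<notin> R)"
    and R: "\<forall>x\<in>R. \<sigma> x \<noteq> x \<and> level (\<sigma> x) \<le> level x"
    and fixed: "\<forall>x\<in>B. \<sigma> x = x \<longleftrightarrow> level (\<sigma> x) = level x \<and> C (level x) (level x)"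
    and gram: "\<forall>x\<in>B. \<forall>y\<in>B.
      b x y = (if y = \<sigma> x \<or> y = x \<and> C (level x) (level (\<sigma> x)) then 1 else 0)"
    using d by - (elim conjE, assumption)+
  show "v \<in> X \<Longrightarrow> v \<in> F q \<Longrightarrow> v \<in> span (B \<inter> F q)" using span by blast
  show "x \<in> B \<Longrightarrow> \<sigma> x \<in> B" "x \<in> B \<Longrightarrow> \<sigma> (\<sigma> x) = x" using invol by blast+
  show "x \<in> B \<Longrightarrow> \<sigma> x \<noteq> x \<Longrightarrow> \<sigma> x \<in> R \<longleftrightarrow> x \<notin> R" using repr by blast
  show "x \<in> R \<Longrightarrow> \<sigma> x \<noteq> x" "x \<in> R \<Longrightarrow> level (\<sigma> x) \<le> level x" using R by blast+
  show "x \<in> B \<Longrightarrow> \<sigma> x = x \<longleftrightarrow> level (\<sigma> x) = level x \<and> C (level x) (level x)"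
    using fixed by blast
  show "x \<in> B \<Longrightarrow> y \<in> B \<Longrightarrow>
      b x y = (if y = \<sigma> x \<or> y = x \<and> C (level x) (level (\<sigma> x)) then 1 else 0)"
    using gram by blast
qed

lemma normal_basis_empty: "normal_basis C {0} {} \<sigma> {}"
  unfolding normal_basis_def by (simp add: subset_iff)

lemma normal_basis_single:
  assumes f: "f \<in> num UNIV q q" and ff: "b f f = 1" and C: "C q q"
  shows "normal_basis C (span {f}) {f} (\<lambda>x. x) {}"
proof -
  have inF: "f \<in> F q" "f \<in> orth b (F (q - 1))" using f by (auto simp: num_def)
  have notin: "f \<notin> F (q - 1)" using inF ff orthD by force
  then have level: "level f = q" using inF by (intro level_eqI)
  have "v \<in> span ({f} \<inter> F j)" if v: "v \<in> span {f}" "v \<in> F j" for v j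
  proof (cases "f \<in> F j")
    case False
    then have "v \<in> F (q - 1)" using v inF by (intro flag_less) (auto simp: mem_flag_iff)
    then have "b v f = 0" using inF orthD by blast
    moreover obtain c where "v = scale c f" using v by (auto simp: span_singleton)
    ultimately have "v = 0" using ff by (simp add: form_simps)
    then show ?thesis by (simp add: span_zero)
  qed (use v in simp)
  then show ?thesis
    using ff C level by (auto simp: normal_basis_def span_base)
qed

text \<open>The pairing pins down the levels: \<open>f\<close> cannot lie in \<open>F (q - 1)\<close>, to which \<open>e\<close> is
  orthogonal, nor \<open>e\<close> in \<open>F (r - 1)\<close>.\<close>

lemma normal_basis_pair:
  assumes f: "f \<in> num UNIV q r" and e: "e \<in> num UNIV r q"
    and ef: "b e f = 1" and ee: "b e e = 0"
    and ff: "b f f = (if C q r then 1 else 0)"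
    and C: "\<And>q r. C q r \<Longrightarrow> r \<le> q" and rq: "r < q \<or> r = q \<and> \<not> C q r"
  shows "normal_basis C (span {e, f}) {e, f} (\<lambda>x. if x = e then f else if x = f then e else x) {f}"
proof -
  have fe: "b f e = 1" using ef symmetric by metis
  have ne: "e \<noteq> f" using ef ee by auto
  have inF: "f \<in> F q" "f \<in> orth b (F (r - 1))" "e \<in> F r" "e \<in> orth b (F (q - 1))"
    using e f by (auto simp: num_def)
  have notin: "f \<notin> F (q - 1)" "e \<notin> F (r - 1)" using inF ef fe orthD by force+
  then have level: "level f = q" "level e = r" using inF by (auto intro: level_eqI)
  have "v \<in> span ({e, f} \<inter> F j)" if v: "v \<in> span {e, f}" "v \<in> F j" for v j
  proof -
    obtain c d where cd: "v = scale c e + scale d f" using v(1) by (rule span_pairE)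
    have "scale d f \<in> span ({e, f} \<inter> F j)"
    proof (cases "f \<in> F j")
      case True
      then show ?thesis by (intro span_scale span_base) auto
    next
      case False
      then have "v \<in> F (q - 1)" using v inF by (intro flag_less) (auto simp: mem_flag_iff)
      then have "b v e = 0" using inF orthD by blast
      then have "d = 0" using cd ee fe by (simp add: form_simps)
      then show ?thesis by (simp add: span_zero)
    qed
    moreover have "scale c e \<in> span ({e, f} \<inter> F j)"
    proof (cases "e \<in> F j")
      case True
      then show ?thesis by (intro span_scale span_base) auto
    next
      case False
      then have "j < r" "j < q" using rq level by (auto simp: mem_flag_iff)
      then have "v \<in> F (q - 1)" "v \<in> F (r - 1)" using v(2) flag_less by blast+
      then have "b v e = 0" "b v f = 0" using inF orthD by blast+
      then have "c = 0" using cd ee fe ef by (simp add: form_simps)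
      then show ?thesis by (simp add: span_zero)
    qed
    ultimately show ?thesis unfolding cd by (intro span_add)
  qed
  then have adapted: "span {e, f} \<inter> F j \<subseteq> span ({e, f} \<inter> F j)" for j by blast
  let ?\<sigma> = "\<lambda>x. if x = e then f else if x = f then e else x"
  have swap: "?\<sigma> e = f" "?\<sigma> f = e" using ne by simp_all
  have Crq: "\<not> C r q" using C[of r q] rq by auto
  have gram: "b x y = (if y = ?\<sigma> x \<or> y = x \<and> C (level x) (level (?\<sigma> x)) then 1 else 0)"
    if "x \<in> {e, f}" "y \<in> {e, f}" for x y
    using that ef fe ee ff ne Crq unfolding swap insert_iff empty_iff
    by (elim disjE) (simp_all add: level)
  have fixed: "?\<sigma> x = x \<longleftrightarrow> level (?\<sigma> x) = level x \<and> C (level x) (level x)"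
    if "x \<in> {e, f}" for x
    using that rq Crq ne unfolding insert_iff empty_iff by (elim disjE) (auto simp: level)
  show ?thesis
    unfolding normal_basis_def
  proof (intro conjI ballI allI)
    show "{e, f} \<subseteq> span {e, f}" by (rule span_superset)
  qed (use adapted gram fixed rq ne in \<open>auto simp: level\<close>)
qed

lemma normal_basis_orthogonal_sum:
  assumes X: "subspace X" and H: "flag_summand H" "H \<subseteq> X"
    and 1: "normal_basis C H B\<^sub>1 \<sigma>\<^sub>1 R\<^sub>1"
    and 2: "normal_basis C (X \<inter> orth b H) B\<^sub>2 \<sigma>\<^sub>2 R\<^sub>2"
  shows "normal_basis C X (B\<^sub>1 \<union> B\<^sub>2) (\<lambda>x. if x \<in> B\<^sub>1 then \<sigma>\<^sub>1 x else \<sigma>\<^sub>2 x) (R\<^sub>1 \<union> R\<^sub>2)"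
proof -
  let ?\<sigma> = "\<lambda>x. if x \<in> B\<^sub>1 then \<sigma>\<^sub>1 x else \<sigma>\<^sub>2 x"
  have cross: "b x y = 0" "b y x = 0" if "x \<in> B\<^sub>1" "y \<in> B\<^sub>2" for x y
  proof -
    have "x \<in> H" "y \<in> orth b H" using that 1 2 by (auto simp: normal_basis_def)
    then show "b x y = 0" "b y x = 0" using orthD by blast+
  qed
  have disj: "B\<^sub>1 \<inter> B\<^sub>2 = {}"
  proof (rule ccontr)
    assume "B\<^sub>1 \<inter> B\<^sub>2 \<noteq> {}"
    then obtain x where x: "x \<in> B\<^sub>1" "x \<in> B\<^sub>2" by blast
    then have "\<sigma>\<^sub>1 x \<in> B\<^sub>1" using 1 by (simp add: normal_basis_def)
    then have "b x (\<sigma>\<^sub>1 x) = 1" using 1 x by (simp add: normal_basis_def)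
    then show False using cross(2)[OF \<open>\<sigma>\<^sub>1 x \<in> B\<^sub>1\<close> x(2)] by simp
  qed
  have adapted: "X \<inter> F q \<subseteq> span ((B\<^sub>1 \<union> B\<^sub>2) \<inter> F q)" for q
  proof
    fix v assume v: "v \<in> X \<inter> F q"
    obtain h x where hx: "v = h + x" "h \<in> H" "x \<in> X \<inter> orth b H"
      "\<And>q. v \<in> F q \<Longrightarrow> h \<in> F q \<and> x \<in> F q"
      by (rule flag_summand_decomposition[OF X H, of v]) (use v in blast)+
    have "h \<in> span (B\<^sub>1 \<inter> F q)" "x \<in> span (B\<^sub>2 \<inter> F q)"
      using hx(2-4) v normal_basisD(3)[OF 1] normal_basisD(3)[OF 2] by blast+
    then have "h \<in> span ((B\<^sub>1 \<union> B\<^sub>2) \<inter> F q)" "x \<in> span ((B\<^sub>1 \<union> B\<^sub>2) \<inter> F q)"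
      using span_mono[of "B\<^sub>1 \<inter> F q" "(B\<^sub>1 \<union> B\<^sub>2) \<inter> F q"]
        span_mono[of "B\<^sub>2 \<inter> F q" "(B\<^sub>1 \<union> B\<^sub>2) \<inter> F q"] by blast+
    then show "v \<in> span ((B\<^sub>1 \<union> B\<^sub>2) \<inter> F q)" unfolding hx(1) by (rule span_add)
  qed
  note D1 = normal_basisD[OF 1] and D2 = normal_basisD[OF 2]
  have B1: "\<sigma>\<^sub>1 x \<in> B\<^sub>1" "x \<notin> B\<^sub>2" "\<sigma>\<^sub>1 x \<notin> B\<^sub>2" "x \<notin> R\<^sub>2" "\<sigma>\<^sub>1 x \<notin> R\<^sub>2" if "x \<in> B\<^sub>1" for x
    using D1(4)[OF that] that D2(6) disj by blast+
  have B2: "\<sigma>\<^sub>2 x \<in> B\<^sub>2" "x \<notin> B\<^sub>1" "\<sigma>\<^sub>2 x \<notin> B\<^sub>1" "x \<notin> R\<^sub>1" "\<sigma>\<^sub>2 x \<notin> R\<^sub>1" if "x \<in> B\<^sub>2" for x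
    using D2(4)[OF that] that D1(6) disj by blast+
  have gram: "b x y = (if y = ?\<sigma> x \<or> y = x \<and> C (level x) (level (?\<sigma> x)) then 1 else 0)"
    if xy: "x \<in> B\<^sub>1 \<union> B\<^sub>2" "y \<in> B\<^sub>1 \<union> B\<^sub>2" for x y
  proof -
    consider "x \<in> B\<^sub>1" "y \<in> B\<^sub>1" | "x \<in> B\<^sub>2" "y \<in> B\<^sub>2" | "x \<in> B\<^sub>1" "y \<in> B\<^sub>2" | "x \<in> B\<^sub>2" "y \<in> B\<^sub>1"
      using xy by blast
    then show ?thesis
    proof cases
      case 1
      then show ?thesis using D1(11) by simp
    next
      case 2
      then show ?thesis using D2(11) B2 by simp
    next
      case 3
      then show ?thesis using cross B1 by auto
    next
      case 4
      then show ?thesis using cross B2 by auto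
    qed
  qed
  have fixed: "?\<sigma> x = x \<longleftrightarrow> level (?\<sigma> x) = level x \<and> C (level x) (level x)"
    if "x \<in> B\<^sub>1 \<union> B\<^sub>2" for x
    using that D1(10) D2(10) B2 by auto
  have repr: "?\<sigma> x \<in> R\<^sub>1 \<union> R\<^sub>2 \<longleftrightarrow> x \<notin> R\<^sub>1 \<union> R\<^sub>2" if "x \<in> B\<^sub>1 \<union> B\<^sub>2" "?\<sigma> x \<noteq> x" for x
    using that D1(7)[of x] D2(7)[of x] B1[of x] B2[of x] by auto
  have R: "?\<sigma> x \<noteq> x \<and> level (?\<sigma> x) \<le> level x" if "x \<in> R\<^sub>1 \<union> R\<^sub>2" for x
    using that D1(6) D2(6) D1(8,9)[of x] D2(8,9)[of x] B1[of x] B2[of x] by auto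
  have invol: "?\<sigma> x \<in> B\<^sub>1 \<union> B\<^sub>2 \<and> ?\<sigma> (?\<sigma> x) = x" if "x \<in> B\<^sub>1 \<union> B\<^sub>2" for x
    using that D1(5)[of x] D2(5)[of x] B1[of x] B2[of x] by auto
  have sets: "finite (B\<^sub>1 \<union> B\<^sub>2)" "B\<^sub>1 \<union> B\<^sub>2 \<subseteq> X" "R\<^sub>1 \<union> R\<^sub>2 \<subseteq> B\<^sub>1 \<union> B\<^sub>2"
    using D1(1,2,6) D2(1,2,6) H by blast+
  show ?thesis
    unfolding normal_basis_def
    by (intro conjI ballI allI impI;
        (rule sets adapted | (rule invol[THEN conjunct1] invol[THEN conjunct2] repr
          R[THEN conjunct1] R[THEN conjunct2] fixed gram; assumption)))
qed

end

section \<open>Existence of normal bases in characteristic two\<close>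

locale perfect_char_two_flagged_space = flagged_space scale b F
  for scale :: "'k::field \<Rightarrow> 'v::ab_group_add \<Rightarrow> 'v"
    and b :: "'v \<Rightarrow> 'v \<Rightarrow> 'k" and F :: "nat \<Rightarrow> 'v set" +
  assumes char_two: "CHAR('k) = 2" and perfect_field: "perfect TYPE('k)"
begin

lemma double_zero: "(x :: 'k) + x = 0"
proof -
  have "of_nat 2 = (0 :: 'k)" using of_nat_CHAR[where 'a = 'k] char_two by simp
  then have "(1 :: 'k) + 1 = 0" by simp
  then have "(1 + 1) * x = 0" by simp
  then show ?thesis by (simp add: distrib_right)
qed

lemma uminus_eq_self: "- x = (x :: 'k)"
  using double_zero[of x] by (simp add: add_eq_0_iff)

lemma square_root:
  obtains c :: 'k where "c * c = x"
proof -
  have "surj (\<lambda>x :: 'k. x ^ 2)" using perfect_field char_two by (auto simp: perfect_def)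
  then obtain c :: 'k where "x = c ^ 2" by (metis surjD)
  then show ?thesis using that by (simp add: power2_eq_square)
qed

lemma square_add: "((x :: 'k) + y) * (x + y) = x * x + y * y"
proof -
  have "(x + y) * (x + y) = x * x + (x * y + x * y) + y * y" by (simp add: algebra_simps)
  then show ?thesis by (simp add: double_zero)
qed

lemma norm_add: "b (x + y) (x + y) = b x x + b y y"
proof -
  have "b (x + y) (x + y) = b x x + (b x y + b x y) + b y y"
    by (simp add: form_simps symmetric[of y x] algebra_simps)
  then show ?thesis by (simp add: double_zero)
qed

lemma norm_scale: "b (scale c x) (scale c x) = c * c * b x x"
  by (simp add: form_simps)

lemma norm_diff: "b (x - y) (x - y) = b x x + b y y"
  using norm_add[of x "scale (- 1) y"] norm_scale[of "- 1" y] by simp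

lemma subspace_isotropic: "subspace (isotropic b)"
  by (auto simp: subspace_def isotropic_def norm_add norm_scale)

lemma isotropic_iff: "x \<in> isotropic b \<longleftrightarrow> b x x = 0"
  by (simp add: isotropic_def)

lemma normalize:
  assumes "b x x \<noteq> 0"
  obtains c where "c \<noteq> 0" "b (scale c x) (scale c x) = 1"
proof -
  obtain c where "c * c = 1 / b x x" by (rule square_root)
  moreover from this have "c \<noteq> 0" using assms by auto
  ultimately show ?thesis using that[of c] assms by (simp add: norm_scale)
qed

text \<open>Adding a multiple of a non-isotropic vector, a square root of the quotient of the two
  values, kills the value of any vector.\<close>

lemma make_isotropic:
  assumes W: "subspace W" and w: "w \<in> W" "b w w \<noteq> 0"
  obtains z where "z \<in> W" "b (y - z) (y - z) = 0"
proof -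
  obtain c where c: "c * c = b y y / b w w" by (rule square_root)
  show ?thesis
  proof (rule that[of "scale c w"])
    show "scale c w \<in> W" using w(1) W by (simp add: subspace_scale)
    show "b (y - scale c w) (y - scale c w) = 0"
      using c w by (simp add: norm_diff norm_scale double_zero)
  qed
qed

text \<open>The condition for \<open>n\<^sup>1\<^sub>q\<^sub>r = 1\<close>: the square root of \<open>b v v\<close> is a linear functional, and it induces
  a nonzero functional on \<open>\<Phi>\<^sub>q\<^sub>r\<close>. The pairs \<open>(q, r)\<close> whose space
  \<open>X \<inter> F q \<inter> orth b (F r)\<close> has a non-isotropic vector form a staircase (they persist when \<open>q\<close> grows
  or \<open>r\<close> decreases), and the pairs defined here sit at its corners.\<close>

definition corner :: "'v set \<Rightarrow> nat \<Rightarrow> nat \<Rightarrow> bool" where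
  "corner X q r \<longleftrightarrow> \<not> num X q r \<subseteq> isotropic b \<and> den X q r \<subseteq> isotropic b"

lemma num_isotropic:
  assumes "q < r" and x: "x \<in> num X q r"
  shows "b x x = 0"
proof -
  have "x \<in> F q" "x \<in> orth b (F (r - 1))" using x by (auto simp: num_def)
  moreover have "F q \<subseteq> F (r - 1)" using assms by (intro flag_le) simp
  ultimately show ?thesis using orthD by blast
qed

lemma corner_nonisotropic:
  assumes "corner X q r"
  obtains v where "v \<in> num X q r" "b v v \<noteq> 0"
  using assms unfolding corner_def isotropic_def by blast

lemma corner_den_isotropic: "corner X q r \<Longrightarrow> w \<in> den X q r \<Longrightarrow> b w w = 0"
  unfolding corner_def isotropic_def by blast

lemma corner_le: "corner X q r \<Longrightarrow> r \<le> q"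
  using num_isotropic[of q r _ X] by (meson corner_nonisotropic not_le)

text \<open>Away from the corners every class of \<open>\<Phi>\<^sub>q\<^sub>r\<close> has an isotropic representative: either the numerator
  is isotropic already, or the denominator contains a non-isotropic vector, by which a representative
  can be corrected.\<close>

lemma isotropic_pair:
  assumes X: "flag_summand X" and rq: "r \<le> q"
    and nd: "\<not> num X q r \<subseteq> den X q r" and nc: "\<not> corner X q r"
  obtains e f where "f \<in> num X q r" "e \<in> num X r q" "b e f = 1" "b e e = 0" "b f f = 0"
proof -
  note sub = flag_summand_subspace[OF X]
  have iso: "\<exists>z\<in>den X q r. b (y - z) (y - z) = 0" if y: "y \<in> num X q r" for y
  proof (cases "num X q r \<subseteq> isotropic b")
    case True
    then have "b y y = 0" using y by (auto simp: isotropic_iff)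
    then show ?thesis
      using subspace_0[OF subspace_den[OF sub]] by (intro bexI[of _ 0]) simp_all
  next
    case False
    then obtain w where w: "w \<in> den X q r" "b w w \<noteq> 0"
      using nc unfolding corner_def isotropic_def by blast
    show ?thesis using make_isotropic[OF subspace_den[OF sub] w, of y] by metis
  qed
  obtain x where x: "x \<in> num X q r" "x \<notin> den X q r" using nd by blast
  obtain z where z: "z \<in> den X q r" "b (x - z) (x - z) = 0" using iso[OF x(1)] by blast
  define f where "f = x - z"
  have f: "f \<in> num X q r"
    unfolding f_def using x z den_subset_num[OF sub, of q r]
    by (intro subspace_diff[OF subspace_num[OF sub]]) auto
  have "f \<notin> den X q r"
  proof
    assume "f \<in> den X q r"
    then have "f + z \<in> den X q r" using z subspace_add[OF subspace_den[OF sub]] by blast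
    then show False using x by (simp add: f_def)
  qed
  with X f obtain e where e: "e \<in> num X r q" "b e f = 1" by (rule num_den_duality)
  show ?thesis
  proof (cases "r = q")
    case False
    then have "b e e = 0" using rq by (intro num_isotropic[OF _ e(1)]) simp
    then show ?thesis using that[of f e] f e z by (simp add: f_def)
  next
    case True
    obtain w where w: "w \<in> den X q r" "b (e - w) (e - w) = 0" using iso e True by blast
    have "e - w \<in> num X r q"
      using e w den_subset_num[OF sub, of q r] True
      by (intro subspace_diff[OF subspace_num[OF sub]]) auto
    moreover have "b w f = 0" using den_orth_num[OF w(1)] f True by blast
    ultimately show ?thesis using that[of f "e - w"] f e z w by (simp add: f_def form_simps)
  qed
qed

text \<open>If the class of \<open>f\<close> spans \<open>\<Phi>\<^sub>q\<^sub>r\<close>, then splitting off \<open>f\<close> together with a partner \<open>e\<close> exhausts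
  \<open>\<Phi>\<^sub>q\<^sub>r\<close>.\<close>

lemma num_orth_subset_den:
  assumes X: "flag_summand X" and f: "f \<in> num X q r"
    and e: "e \<in> num X r q" "b e f = 1"
    and all: "\<And>u. u \<in> num X q r \<Longrightarrow> \<exists>c. u - scale c f \<in> den X q r"
    and u: "u \<in> num X q r" "b u e = 0"
  shows "u \<in> den X q r"
proof -
  obtain c where c: "u - scale c f \<in> den X q r" using all u by blast
  have "b (u - scale c f) e = 0" using den_orth_num[OF c e(1)] .
  then have "c = 0" using u e symmetric[of f e] by (simp add: form_simps)
  then show ?thesis using c by simp
qed

text \<open>The final alternative keeps the induction going: once the span of \<open>e\<close> and \<open>f\<close> is split off, either
  nothing is left of \<open>\<Phi>\<^sub>q\<^sub>r\<close>, or \<open>(q, r)\<close> is still a corner. To get this when \<open>\<Phi>\<^sub>q\<^sub>r\<close> has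
  dimension at least two, \<open>e\<close> is chosen to pair to \<open>1\<close> with \<open>f\<close> and to \<open>0\<close> with a second
  non-isotropic class, so that pairing with \<open>e\<close> is a functional different from the square root of
  \<open>b v v\<close>.\<close>

lemma corner_pair:
  assumes X: "flag_summand X" and rq: "r < q" and c: "corner X q r"
  obtains e f where "f \<in> num X q r" "e \<in> num X r q" "b e f = 1" "b e e = 0" "b f f = 1"
    "(\<forall>u\<in>num X q r. b u e = 0 \<longrightarrow> u \<in> den X q r) \<or>
     (\<exists>u\<in>num X q r. b u e = 0 \<and> b u f = 0 \<and> b u u \<noteq> 0)"
proof -
  note sub = flag_summand_subspace[OF X]
  obtain f0 where f0: "f0 \<in> num X q r" "b f0 f0 \<noteq> 0"
    by (rule corner_nonisotropic[OF c])
  obtain k where k: "k \<noteq> 0" "b (scale k f0) (scale k f0) = 1" using f0(2) by (rule normalize)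
  define f where "f = scale k f0"
  have f: "f \<in> num X q r" "b f f = 1"
    using f0 k sub by (simp_all add: f_def subspace_scale subspace_num)
  have f_den: "f \<notin> den X q r" using corner_den_isotropic[OF c] f(2) by force
  have ee: "b e e = 0" if "e \<in> num X r q" for e using num_isotropic[OF rq that] .
  show ?thesis
  proof (cases "\<forall>u\<in>num X q r. \<exists>c. u - scale c f \<in> den X q r")
    case True
    obtain e where e: "e \<in> num X r q" "b e f = 1" by (rule num_den_duality[OF X f(1) f_den])
    then show ?thesis
      using that[of f e] f ee num_orth_subset_den[OF X f(1) e] True by blast
  next
    case False
    then obtain u0 where u0: "u0 \<in> num X q r" "\<And>c. u0 - scale c f \<notin> den X q r" by blast
    \<comment> \<open>shift by a multiple of \<open>f\<close> to make the value at the second vector \<open>1\<close> too\<close>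
    obtain k where k: "k * k = b u0 u0 + 1" by (rule square_root)
    define u where "u = u0 - scale k f"
    have u: "u \<in> num X q r"
      unfolding u_def using u0 f sub by (simp add: subspace_diff subspace_scale subspace_num)
    have uu: "b u u = 1"
      using k f double_zero[of "b u0 u0"] by (simp add: u_def norm_diff norm_scale add.assoc[symmetric])
    have u_den: "u - scale c f \<notin> den X q r" for c
      using u0(2)[of "k + c"] by (simp add: u_def scale_left_distrib algebra_simps)
    have "f - scale c u \<notin> den X q r" for c
    proof
      assume d: "f - scale c u \<in> den X q r"
      have "c \<noteq> 0" using d f_den by auto
      then have "u - scale (1 / c) f = scale (- 1 / c) (f - scale c u)"
        by (simp add: scale_right_diff_distrib)
      then show False using u_den[of "1 / c"] subspace_scale[OF subspace_den[OF sub] d] by metis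
    qed
    moreover have "u \<notin> den X q r" using u_den[of 0] by simp
    ultimately obtain e where e: "e \<in> num X r q" "b e f = 1" "b e u = 0"
      using num_den_duality_two[OF X f(1) u] by metis
    \<comment> \<open>orthogonal to \<open>e\<close> and \<open>f\<close>, and still in the numerator because of \<open>r < q\<close>\<close>
    define u' where "u' = u - scale (b u f) e"
    have "e \<in> num X q r"
      using e(1) rq flag_le[of r q] orth_flag_le[of "r - 1" "q - 1"] by (auto simp: num_def)
    then have "u' \<in> num X q r"
      unfolding u'_def using u sub by (simp add: subspace_diff subspace_scale subspace_num)
    moreover have "b u' e = 0" "b u' f = 0" "b u' u' \<noteq> 0"
      using e ee[OF e(1)] uu symmetric[of u e]
      by (simp_all add: u'_def norm_diff norm_scale form_simps)
    ultimately show ?thesis using that[of f e] f e ee[OF e(1)] by blast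
  qed
qed

text \<open>On \<open>\<Phi>\<^sub>q\<^sub>q\<close> the form is symmetric and not alternating. The complement of a vector \<open>f\<close> with
  \<open>b f f = 1\<close> is alternating only if pairing with \<open>f\<close> is the square root of \<open>b v v\<close>. There is just
  one such class, and in dimension at least two it can be avoided.\<close>

lemma corner_single:
  assumes X: "flag_summand X" and c: "corner X q q"
  obtains f where "f \<in> num X q q" "b f f = 1"
    "(\<forall>u\<in>num X q q. b u f = 0 \<longrightarrow> u \<in> den X q q) \<or>
     (\<exists>u\<in>num X q q. b u f = 0 \<and> b u u \<noteq> 0)"
proof -
  note sub = flag_summand_subspace[OF X]
  obtain f0 where f0: "f0 \<in> num X q q" "b f0 f0 \<noteq> 0"
    by (rule corner_nonisotropic[OF c])
  obtain k where k: "k \<noteq> 0" "b (scale k f0) (scale k f0) = 1" using f0(2) by (rule normalize)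
  define f where "f = scale k f0"
  have f: "f \<in> num X q q" "b f f = 1"
    using f0 k sub by (simp_all add: f_def subspace_scale subspace_num)
  show ?thesis
  proof (cases "\<forall>u\<in>num X q q. \<exists>c. u - scale c f \<in> den X q q")
    case True
    then show ?thesis
      using that[of f] f num_orth_subset_den[OF X f(1) f] by blast
  next
    case False
    then obtain u0 where u0: "u0 \<in> num X q q" "\<And>c. u0 - scale c f \<notin> den X q q" by blast
    obtain k where k: "k * k = b u0 u0" by (rule square_root)
    define w where "w = u0 - scale k f"
    have w: "w \<in> num X q q" "w \<notin> den X q q"
      unfolding w_def using u0 f sub by (simp_all add: subspace_diff subspace_scale subspace_num)
    have ww: "b w w = 0"
      using k f by (simp add: w_def norm_diff norm_scale double_zero)
    obtain u where u: "u \<in> num X q q" "b u w = 1" by (rule num_den_duality[OF X w])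
    \<comment> \<open>\<open>f\<close> and \<open>f + w\<close> pair differently with \<open>u\<close>, so one of them does not reproduce its value\<close>
    have "\<exists>g\<in>{f, f + w}. b u g * b u g \<noteq> b u u"
    proof (rule ccontr)
      assume "\<not> ?thesis"
      then have "b u f * b u f = b u u" "b u (f + w) * b u (f + w) = b u u" by auto
      then have "b u w * b u w = 0" by (simp add: form_simps(3) square_add)
      then show False using u by simp
    qed
    then obtain g where g: "g \<in> {f, f + w}" "b u g * b u g \<noteq> b u u" by blast
    have g_num: "g \<in> num X q q" using g(1) f w sub by (auto simp: subspace_add subspace_num)
    have gg: "b g g = 1" using g(1) f ww by (auto simp: norm_add)
    define u' where "u' = u - scale (b u g) g"
    have "u' \<in> num X q q"
      unfolding u'_def using u g_num sub by (simp add: subspace_diff subspace_scale subspace_num)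
    moreover have "b u' g = 0" using gg by (simp add: u'_def form_simps)
    moreover have "b u' u' \<noteq> 0"
    proof
      assume "b u' u' = 0"
      then have "b u u + b u g * b u g = 0" using gg by (simp add: u'_def norm_diff norm_scale)
      then have "b u u = b u g * b u g" using uminus_eq_self by (metis add_eq_0_iff)
      then show False using g by simp
    qed
    ultimately show ?thesis using that[of g] g_num gg by blast
  qed
qed

lemma complement_num_subset_den:
  assumes X: "flag_summand X" and H: "flag_summand H" "H \<subseteq> X"
    and "\<not> num (X \<inter> orth b H) q r \<subseteq> den (X \<inter> orth b H) q r"
  shows "\<not> num X q r \<subseteq> den X q r"
proof
  assume le: "num X q r \<subseteq> den X q r"
  have "num (X \<inter> orth b H) q r \<subseteq> den (X \<inter> orth b H) q r"
  proof
    fix x assume x: "x \<in> num (X \<inter> orth b H) q r"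
    then have "x \<in> den X q r" "x \<in> orth b H" using le by (auto simp: num_def)
    then show "x \<in> den (X \<inter> orth b H) q r"
      by (rule den_complement[OF flag_summand_subspace[OF X] H])
  qed
  with assms show False by blast
qed

text \<open>An isotropic summand contributes nothing to \<open>b v v\<close>, so splitting it off changes neither condition
  in the definition of a corner.\<close>

lemma corner_isotropic_complement:
  assumes X: "flag_summand X" and H: "flag_summand H" "H \<subseteq> X" and iso: "H \<subseteq> isotropic b"
  shows "corner (X \<inter> orth b H) q r \<longleftrightarrow> corner X q r"
proof -
  note sub = flag_summand_subspace[OF X]
  let ?Y = "X \<inter> orth b H"
  have "num ?Y q r \<subseteq> isotropic b \<longleftrightarrow> num X q r \<subseteq> isotropic b"
  proof
    show "num X q r \<subseteq> isotropic b \<Longrightarrow> num ?Y q r \<subseteq> isotropic b"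
      using num_mono[of ?Y X q r] by blast
    assume Y: "num ?Y q r \<subseteq> isotropic b"
    show "num X q r \<subseteq> isotropic b"
    proof
      fix v assume "v \<in> num X q r"
      then obtain h x where "v = h + x" "h \<in> num H q r" "x \<in> num ?Y q r"
        by (rule num_decomposition[OF sub H])
      then show "v \<in> isotropic b"
        using iso Y by (auto simp: num_def intro!: subspace_add[OF subspace_isotropic])
    qed
  qed
  moreover have "den ?Y q r \<subseteq> isotropic b \<longleftrightarrow> den X q r \<subseteq> isotropic b"
  proof
    show "den X q r \<subseteq> isotropic b \<Longrightarrow> den ?Y q r \<subseteq> isotropic b"
      using den_mono[of ?Y X q r] by blast
    assume Y: "den ?Y q r \<subseteq> isotropic b"
    show "den X q r \<subseteq> isotropic b"
    proof
      fix v assume "v \<in> den X q r"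
      then obtain h x where hx: "v = h + x" "h \<in> den H q r" "x \<in> den ?Y q r"
        by (rule den_decomposition[OF sub H])
      moreover have "h \<in> isotropic b"
        using hx iso den_subset[OF flag_summand_subspace[OF H(1)]] by blast
      ultimately show "v \<in> isotropic b"
        using Y subspace_add[OF subspace_isotropic] by blast
    qed
  qed
  ultimately show ?thesis by (simp add: corner_def)
qed

text \<open>Suppose that the non-isotropic vector that witnesses the corner \<open>(q', r')\<close> has its non-isotropic
  part \<open>h\<close> in \<open>H\<close>. Since \<open>h\<close> pairs nontrivially with \<open>e\<close>, it cannot lie too early in the flag or be
  orthogonal to too much of it, so \<open>q \<le> q'\<close> and \<open>r' \<le> r\<close>. Then \<open>f\<close> is in the denominator
  for \<open>(q', r')\<close>, which has isotropic vectors only, unless \<open>(q', r') = (q, r)\<close>.\<close>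

lemma corner_complement:
  assumes X: "flag_summand X" and H: "flag_summand H" "H \<subseteq> X"
    and f: "f \<in> num X q r" "b f f \<noteq> 0"
    and e: "e \<in> num X r q" and He: "\<And>h. h \<in> H \<Longrightarrow> b h h \<noteq> 0 \<Longrightarrow> b h e \<noteq> 0"
    and rest: "num (X \<inter> orth b H) q r \<subseteq> den (X \<inter> orth b H) q r \<or>
      (\<exists>u\<in>num (X \<inter> orth b H) q r. b u u \<noteq> 0)"
    and c: "corner X q' r'"
    and nd: "\<not> num (X \<inter> orth b H) q' r' \<subseteq> den (X \<inter> orth b H) q' r'"
  shows "corner (X \<inter> orth b H) q' r'"
proof -
  note sub = flag_summand_subspace[OF X]
  let ?Y = "X \<inter> orth b H"
  have den: "den ?Y q' r' \<subseteq> isotropic b"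
    using c den_mono[of ?Y X q' r'] by (auto simp: corner_def)
  obtain v where v: "v \<in> num X q' r'" "b v v \<noteq> 0"
    by (rule corner_nonisotropic[OF c])
  obtain h x where hx: "v = h + x" "h \<in> num H q' r'" "x \<in> num ?Y q' r'"
    by (rule num_decomposition[OF sub H v(1)])
  show ?thesis
  proof (cases "b x x = 0")
    case False
    then have "\<not> num ?Y q' r' \<subseteq> isotropic b" using hx(3) by (auto simp: isotropic_iff)
    then show ?thesis using den by (simp add: corner_def)
  next
    case True
    then have "b h h \<noteq> 0" using v(2) by (simp add: hx(1) norm_add)
    then have he: "b h e \<noteq> 0" using He hx(2) by (auto simp: num_def)
    have eF: "e \<in> F r" "e \<in> orth b (F (q - 1))" using e by (auto simp: num_def)
    have hF: "h \<in> F q'" "h \<in> orth b (F (r' - 1))" using hx(2) by (auto simp: num_def)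
    have fF: "f \<in> X" "f \<in> F q" "f \<in> orth b (F (r - 1))" using f by (auto simp: num_def)
    have "\<not> q' \<le> q - 1"
      using he eF(2) hF(1) flag_le[of q' "q - 1"] orthD(2)[OF eF(2)] by blast
    then have qq: "q \<le> q'" by simp
    have "\<not> r \<le> r' - 1"
      using he eF(1) hF(2) flag_le[of r "r' - 1"] orthD(1)[OF hF(2)] by blast
    then have rr: "r' \<le> r" by simp
    have f_den: "f \<notin> den X q' r'" using corner_den_isotropic[OF c] f(2) by force
    have zero: "0 \<in> X \<inter> F j \<inter> orth b (F i)" for i j
      using subspace_0[OF sub] subspace_0[OF flag_subspace] subspace_0[OF subspace_orth] by blast
    have "q' = q"
    proof (rule ccontr)
      assume "q' \<noteq> q"
      then have "f \<in> X \<inter> F (q' - 1) \<inter> orth b (F (r' - 1))"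
        using qq rr fF flag_le[of q "q' - 1"] orth_flag_le[OF diff_le_mono[OF rr] fF(3)] by fastforce
      then have "0 + f \<in> den X q' r'" unfolding den_def using zero by (intro set_plus_intro)
      then show False using f_den by simp
    qed
    moreover have "r' = r"
    proof (rule ccontr)
      assume "r' \<noteq> r"
      then have "f \<in> X \<inter> F q' \<inter> orth b (F r')"
        using qq rr fF flag_le[of q q'] orth_flag_le[OF _ fF(3), of r'] by fastforce
      then have "f + 0 \<in> den X q' r'" unfolding den_def using zero by (intro set_plus_intro)
      then show False using f_den by simp
    qed
    ultimately have "\<not> num ?Y q' r' \<subseteq> isotropic b"
      using rest nd by (auto simp: isotropic_iff)
    then show ?thesis using den by (simp add: corner_def)
  qed
qed

lemma span_pair_memD:
  assumes "v \<in> orth b (span {e, f})"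
  shows "b v e = 0" "b v f = 0"
  using assms by (auto intro!: orthD(1) span_base)

lemma orth_span_pairI:
  assumes "b v e = 0" and "b v f = 0"
  shows "v \<in> orth b (span {e, f})"
proof -
  have "span {e, f} \<subseteq> orth b {v}"
    using assms by (intro span_minimal subspace_orth) (auto simp: orth_def symmetric)
  then show ?thesis by (auto simp: orth_def symmetric)
qed

lemma dim_complement_less:
  assumes X: "subspace X" and f: "f \<in> H" "H \<subseteq> X" "g \<in> H" "b f g \<noteq> 0"
  shows "dim (X \<inter> orth b H) < dim X"
proof -
  have "f \<notin> orth b H" using f orthD(1) by blast
  then have "X \<inter> orth b H \<subset> X" using f by blast
  then show ?thesis
    using X by (intro dim_psubset) (simp add: span_eq_iff[THEN iffD2] subspace_inter subspace_orth)
qed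

text \<open>The order of the splittings matters. As long as some nonzero \<open>\<Phi>\<^sub>q\<^sub>r\<close> with \<open>r \<le> q\<close> is not marked
  by \<open>C\<close>, an isotropic pair is split off there, which leaves all corners intact. The isotropic
  representatives may need a non-isotropic vector of a denominator, and splitting off a block at a corner
  could remove all of these, so the corners have to wait until nothing else is left. The fixed predicate \<open>C\<close>
  remembers the corners of the original space; it has to agree with the corners of the current summand
  only where \<open>\<Phi>\<^sub>q\<^sub>r\<close> is nonzero, because a corner disappears once its \<open>\<Phi>\<^sub>q\<^sub>r\<close> is used up.\<close>

lemma normal_basis_exists:
  assumes C: "\<And>q r. C q r \<Longrightarrow> r \<le> q"
  assumes "flag_summand X"
    and "\<And>q r. r \<le> q \<Longrightarrow> \<not> num X q r \<subseteq> den X q r \<Longrightarrow> C q r \<longleftrightarrow> corner X q r"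
  shows "\<exists>B \<sigma> R. normal_basis C X B \<sigma> R"
  using assms(2,3)
proof (induction "dim X" arbitrary: X rule: less_induct)
  case less
  note X = less.prems(1) and corners = less.prems(2)
  note sub = flag_summand_subspace[OF X]
  have step: "\<exists>B \<sigma> R. normal_basis C X B \<sigma> R"
    if H: "flag_summand H" "H \<subseteq> X" and B: "normal_basis C H B \<sigma> R"
      and fg: "f \<in> H" "g \<in> H" "b f g \<noteq> 0"
      and rest: "\<And>q r. r \<le> q \<Longrightarrow> \<not> num X q r \<subseteq> den X q r \<Longrightarrow>
        \<not> num (X \<inter> orth b H) q r \<subseteq> den (X \<inter> orth b H) q r \<Longrightarrow>
        C q r \<longleftrightarrow> corner (X \<inter> orth b H) q r" for H B \<sigma> R f g
  proof -
    have "dim (X \<inter> orth b H) < dim X" by (rule dim_complement_less[OF sub fg(1) H(2) fg(2,3)])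
    moreover have "flag_summand (X \<inter> orth b H)" by (rule flag_summand_complement[OF X H])
    moreover have "C q r \<longleftrightarrow> corner (X \<inter> orth b H) q r"
      if "r \<le> q" "\<not> num (X \<inter> orth b H) q r \<subseteq> den (X \<inter> orth b H) q r" for q r
      using rest[OF that(1) complement_num_subset_den[OF X H that(2)] that(2)] .
    ultimately have "\<exists>B \<sigma> R. normal_basis C (X \<inter> orth b H) B \<sigma> R"
      by (rule less.hyps)
    then obtain B' \<sigma>' R' where B': "normal_basis C (X \<inter> orth b H) B' \<sigma>' R'" by (elim exE)
    show ?thesis by (intro exI) (rule normal_basis_orthogonal_sum[OF sub H B B'])
  qed
  consider (zero) "X = {0}"
    | (isotropic) q r where "r \<le> q" "\<not> num X q r \<subseteq> den X q r" "\<not> C q r"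
    | (corner) q r where "r \<le> q" "\<not> num X q r \<subseteq> den X q r" "C q r"
        "\<And>q' r'. r' \<le> q' \<Longrightarrow> \<not> num X q' r' \<subseteq> den X q' r' \<Longrightarrow> C q' r'"
  proof (cases "\<exists>q r. r \<le> q \<and> \<not> num X q r \<subseteq> den X q r \<and> \<not> C q r")
    case False
    show ?thesis
    proof (cases "X = {0}")
      case nonzero: False
      obtain q r where "r \<le> q" "\<not> num X q r \<subseteq> den X q r"
        by (rule exists_num_not_subset_den[OF X nonzero])
      then show ?thesis using False by (intro that(3)) blast+
    qed (rule that(1))
  qed (use that(2) in blast)
  then show ?case
  proof cases
    case zero
    show ?thesis unfolding zero by (intro exI) (rule normal_basis_empty)
  next
    case isotropic
    then have "\<not> corner X q r" using corners by blast
    then obtain e f where ef: "f \<in> num X q r" "e \<in> num X r q" "b e f = 1" "b e e = 0" "b f f = 0"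
      by (rule isotropic_pair[OF X isotropic(1,2)])
    let ?H = "span {e, f}"
    have num: "f \<in> num UNIV q r" "e \<in> num UNIV r q" using ef by (auto simp: num_def)
    have H: "flag_summand ?H" by (rule flag_summand_pair[OF num isotropic(1) ef(3,4)])
    have HX: "?H \<subseteq> X" using ef sub by (intro span_minimal) (auto simp: num_def)
    have iso: "?H \<subseteq> isotropic b"
      using ef by (intro span_minimal subspace_isotropic) (auto simp: isotropic_iff)
    have nb: "normal_basis C ?H {e, f} (\<lambda>x. if x = e then f else if x = f then e else x) {f}"
      using isotropic ef C by (intro normal_basis_pair[OF num]) auto
    show ?thesis
    proof (rule step[OF H HX nb, of e f])
      show "C q r \<longleftrightarrow> corner (X \<inter> orth b ?H) q r"
        if "r \<le> q" "\<not> num X q r \<subseteq> den X q r" for q r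
        using corners[OF that] corner_isotropic_complement[OF X H HX iso] by simp
    qed (use ef in \<open>auto simp: span_base\<close>)
  next
    case corner
    have all_corner: "corner X q' r'"
      if "r' \<le> q'" "\<not> num X q' r' \<subseteq> den X q' r'" for q' r'
      using corner(4)[OF that] corners[OF that] by blast
    have c: "corner X q r" using all_corner corner by blast
    show ?thesis
    proof (cases "r = q")
      case False
      then have rq: "r < q" using corner by simp
      obtain e f where ef: "f \<in> num X q r" "e \<in> num X r q" "b e f = 1" "b e e = 0" "b f f = 1"
        and rest: "(\<forall>u\<in>num X q r. b u e = 0 \<longrightarrow> u \<in> den X q r) \<or>
          (\<exists>u\<in>num X q r. b u e = 0 \<and> b u f = 0 \<and> b u u \<noteq> 0)"
        by (rule corner_pair[OF X rq c])
      let ?H = "span {e, f}"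
      have num: "f \<in> num UNIV q r" "e \<in> num UNIV r q" using ef by (auto simp: num_def)
      have H: "flag_summand ?H" by (rule flag_summand_pair[OF num corner(1) ef(3,4)])
      have HX: "?H \<subseteq> X" using ef sub by (intro span_minimal) (auto simp: num_def)
      have nb: "normal_basis C ?H {e, f} (\<lambda>x. if x = e then f else if x = f then e else x) {f}"
        using corner rq ef C by (intro normal_basis_pair[OF num]) auto
      have He: "b h e \<noteq> 0" if h: "h \<in> ?H" "b h h \<noteq> 0" for h
      proof -
        obtain s t where st: "h = scale s e + scale t f" using h(1) by (rule span_pairE)
        then show ?thesis using h(2) ef symmetric[of f e]
          by (simp add: norm_add norm_scale) (simp add: form_simps)
      qed
      have rest': "num (X \<inter> orth b ?H) q r \<subseteq> den (X \<inter> orth b ?H) q r \<or>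
        (\<exists>u\<in>num (X \<inter> orth b ?H) q r. b u u \<noteq> 0)"
        using rest
      proof
        assume all: "\<forall>u\<in>num X q r. b u e = 0 \<longrightarrow> u \<in> den X q r"
        have "u \<in> den (X \<inter> orth b ?H) q r" if u: "u \<in> num (X \<inter> orth b ?H) q r" for u
        proof (rule den_complement[OF sub H HX])
          show o: "u \<in> orth b ?H" using u by (auto simp: num_def)
          have "u \<in> num X q r" using u by (auto simp: num_def)
          then show "u \<in> den X q r" using all span_pair_memD(1)[OF o] by blast
        qed
        then show ?thesis by blast
      next
        assume "\<exists>u\<in>num X q r. b u e = 0 \<and> b u f = 0 \<and> b u u \<noteq> 0"
        then obtain u where u: "u \<in> num X q r" "b u e = 0" "b u f = 0" "b u u \<noteq> 0" by blast
        then have "u \<in> num (X \<inter> orth b ?H) q r"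
          using orth_span_pairI[OF u(2,3)] by (auto simp: num_def)
        then show ?thesis using u by blast
      qed
      show ?thesis
      proof (rule step[OF H HX nb, of e f])
        fix q' r' assume le: "r' \<le> q'" and nd: "\<not> num X q' r' \<subseteq> den X q' r'"
          and nd': "\<not> num (X \<inter> orth b ?H) q' r' \<subseteq> den (X \<inter> orth b ?H) q' r'"
        have "corner (X \<inter> orth b ?H) q' r'"
          by (rule corner_complement[OF X H HX ef(1) _ ef(2) He rest' all_corner[OF le nd] nd'])
            (use ef in auto)
        then show "C q' r' \<longleftrightarrow> corner (X \<inter> orth b ?H) q' r'" using corner(4)[OF le nd] by simp
      qed (use ef in \<open>auto simp: span_base\<close>)
    next
      case True
      obtain f where f: "f \<in> num X q q" "b f f = 1"
        and rest: "(\<forall>u\<in>num X q q. b u f = 0 \<longrightarrow> u \<in> den X q q) \<or>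
          (\<exists>u\<in>num X q q. b u f = 0 \<and> b u u \<noteq> 0)"
        by (rule corner_single[OF X c[unfolded True]])
      let ?H = "span {f, f}"
      have num: "f \<in> num UNIV q q" using f by (auto simp: num_def)
      have H: "flag_summand ?H" using flag_summand_single[OF num f(2)] by simp
      have HX: "?H \<subseteq> X" using f sub by (intro span_minimal) (auto simp: num_def)
      have nb: "normal_basis C ?H {f} (\<lambda>x. x) {}"
        using normal_basis_single[OF num f(2)] corner True by simp
      have He: "b h f \<noteq> 0" if "h \<in> ?H" "b h h \<noteq> 0" for h
        using that f by (auto simp: span_singleton form_simps)
      have rest': "num (X \<inter> orth b ?H) q q \<subseteq> den (X \<inter> orth b ?H) q q \<or>
        (\<exists>u\<in>num (X \<inter> orth b ?H) q q. b u u \<noteq> 0)"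
        using rest
      proof
        assume all: "\<forall>u\<in>num X q q. b u f = 0 \<longrightarrow> u \<in> den X q q"
        have "u \<in> den (X \<inter> orth b ?H) q q" if u: "u \<in> num (X \<inter> orth b ?H) q q" for u
        proof (rule den_complement[OF sub H HX])
          show o: "u \<in> orth b ?H" using u by (auto simp: num_def)
          have "u \<in> num X q q" using u by (auto simp: num_def)
          then show "u \<in> den X q q" using all span_pair_memD(1)[OF o] by blast
        qed
        then show ?thesis by blast
      next
        assume "\<exists>u\<in>num X q q. b u f = 0 \<and> b u u \<noteq> 0"
        then obtain u where u: "u \<in> num X q q" "b u f = 0" "b u u \<noteq> 0" by blast
        then have "u \<in> num (X \<inter> orth b ?H) q q"
          using orth_span_pairI[OF u(2,2)] by (auto simp: num_def)
        then show ?thesis using u by blast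
      qed
      show ?thesis
      proof (rule step[OF H HX nb, of f f])
        fix q' r' assume le: "r' \<le> q'" and nd: "\<not> num X q' r' \<subseteq> den X q' r'"
          and nd': "\<not> num (X \<inter> orth b ?H) q' r' \<subseteq> den (X \<inter> orth b ?H) q' r'"
        have "corner (X \<inter> orth b ?H) q' r'"
          by (rule corner_complement[OF X H HX f(1) _ f(1) He rest' all_corner[OF le nd] nd'])
            (use f in auto)
        then show "C q' r' \<longleftrightarrow> corner (X \<inter> orth b ?H) q' r'" using corner(4)[OF le nd] by simp
      qed (use f in \<open>auto simp: span_base\<close>)
    qed
  qed
qed

end

section \<open>The invariants in terms of a normal basis\<close>

context flagged_space
begin

lemma n_inv_eq_dim: "n_inv scale b F q r = dim (num UNIV q r) - dim (den UNIV q r)"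
  unfolding n_inv_def Phi_def num_UNIV[symmetric] den_UNIV[symmetric]
  by (intro dim_quotient_space_subset subspace_num subspace_den den_subset_num subspace_UNIV)

end

context perfect_char_two_flagged_space
begin

text \<open>Any vector of \<open>U\<close> becomes isotropic after subtraction of a suitable multiple of \<open>u\<close>, since every
  scalar is a square.\<close>

lemma dim_Int_isotropic:
  assumes U: "subspace U" and u: "u \<in> U" "b u u \<noteq> 0"
  shows "dim U = Suc (dim (U \<inter> isotropic b))"
proof -
  have sub: "subspace (U \<inter> isotropic b)" using U by (simp add: subspace_inter subspace_isotropic)
  have "span (insert u (U \<inter> isotropic b)) = U"
  proof
    show "span (insert u (U \<inter> isotropic b)) \<subseteq> U" using U u by (intro span_minimal) auto
    show "U \<subseteq> span (insert u (U \<inter> isotropic b))"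
    proof
      fix v assume v: "v \<in> U"
      obtain k where k: "k * k = b v v / b u u" by (rule square_root)
      have "v - scale k u \<in> U \<inter> isotropic b"
        using v u U k by (simp add: subspace_diff subspace_scale isotropic_iff norm_diff norm_scale
            double_zero)
      then show "v \<in> span (insert u (U \<inter> isotropic b))"
        unfolding span_insert by (auto intro: span_base)
    qed
  qed
  moreover have "u \<notin> span (U \<inter> isotropic b)"
    using u sub by (simp add: span_eq_iff[THEN iffD2] isotropic_iff)
  ultimately show ?thesis using dim_insert[of u "U \<inter> isotropic b"] by (metis dim_span Suc_eq_plus1)
qed

text \<open>If the denominator contains a non-isotropic vector, every class has an isotropic representative and the
  difference of dimensions is \<open>0\<close>. Otherwise the isotropic classes form a hyperplane, unless all
  classes are isotropic.\<close>

lemma n1_inv_eq_corner: "n1_inv scale b F q r = (if corner UNIV q r then 1 else 0)"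
proof -
  let ?U = "num UNIV q r" and ?W = "den UNIV q r" and ?I = "isotropic b"
  have U: "subspace ?U" and W: "subspace ?W" by (simp_all add: subspace_num subspace_den)
  have WU: "?W \<subseteq> ?U" by (simp add: den_subset_num)
  have UI: "subspace (?U \<inter> ?I)" using U by (simp add: subspace_inter subspace_isotropic)
  have "Phi scale b F q r\<lparr>carrier := Phi0 b F q r\<rparr> = quotient_space scale (?U \<inter> ?I) ?W"
    by (simp add: Phi_def Phi0_def quotient_space_def num_UNIV den_UNIV)
  then have n1: "n1_inv scale b F q r = (dim ?U - dim ?W) - (dim (?U \<inter> ?I + ?W) - dim ?W)"
    using n_inv_eq_dim[of q r] dim_quotient_space[OF UI W] by (simp add: n1_inv_def n_inv_def)
  show ?thesis
  proof (cases "corner UNIV q r")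
    case True
    then have "?W \<subseteq> ?U \<inter> ?I" using WU by (auto simp: corner_def)
    then have "?U \<inter> ?I + ?W = ?U \<inter> ?I"
      using subspace_add[OF UI] subspace_0[OF W] by (force simp: set_plus_def subset_iff)
    moreover have "dim ?W \<le> dim (?U \<inter> ?I)" using \<open>?W \<subseteq> ?U \<inter> ?I\<close> by (rule dim_subset)
    moreover obtain u where "u \<in> ?U" "b u u \<noteq> 0" by (rule corner_nonisotropic[OF True])
    then have "dim ?U = Suc (dim (?U \<inter> ?I))" by (rule dim_Int_isotropic[OF U])
    ultimately show ?thesis using True n1 by simp
  next
    case False
    have "?U \<subseteq> ?U \<inter> ?I + ?W"
    proof
      fix x assume x: "x \<in> ?U"
      have "\<exists>z\<in>?W. b (x - z) (x - z) = 0"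
      proof (cases "b x x = 0")
        case True
        then show ?thesis using subspace_0[OF W] by (intro bexI[of _ 0]) simp_all
      next
        case nonzero: False
        then have "\<not> ?U \<subseteq> ?I" using x by (auto simp: isotropic_def)
        then obtain w where w: "w \<in> ?W" "b w w \<noteq> 0"
          using False unfolding corner_def isotropic_def by blast
        obtain z where "z \<in> ?W" "b (x - z) (x - z) = 0" by (rule make_isotropic[OF W w])
        then show ?thesis by blast
      qed
      then obtain z where z: "z \<in> ?W" "b (x - z) (x - z) = 0" by blast
      then have "x - z \<in> ?U \<inter> ?I" using x WU subspace_diff[OF U, of x z] by (auto simp: isotropic_iff)
      then have "(x - z) + z \<in> ?U \<inter> ?I + ?W" using z(1) by (rule set_plus_intro)
      then show "x \<in> ?U \<inter> ?I + ?W" by simp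
    qed
    then have "dim ?U \<le> dim (?U \<inter> ?I + ?W)" by (rule dim_subset)
    then show ?thesis using False n1 by simp
  qed
qed

end

locale normal_basis_of_space = flagged_space scale b F
  for scale :: "'k::field \<Rightarrow> 'v::ab_group_add \<Rightarrow> 'v"
    and b :: "'v \<Rightarrow> 'v \<Rightarrow> 'k" and F :: "nat \<Rightarrow> 'v set" +
  fixes C :: "nat \<Rightarrow> nat \<Rightarrow> bool" and B :: "'v set" and \<sigma> :: "'v \<Rightarrow> 'v" and R :: "'v set"
  assumes C_le: "C q r \<Longrightarrow> r \<le> q"
    and normal: "normal_basis C UNIV B \<sigma> R"
begin

lemmas normal_basis_facts = normal_basisD[OF normal]
lemmas finite_B = normal_basis_facts(1)
lemmas span_flag = normal_basis_facts(3)[OF UNIV_I]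
lemmas sigma_B = normal_basis_facts(4)
lemmas sigma_sigma = normal_basis_facts(5)
lemmas R_subset = normal_basis_facts(6)
lemmas sigma_R_iff = normal_basis_facts(7)
lemmas R_not_fixed = normal_basis_facts(8)
lemmas R_level = normal_basis_facts(9)
lemmas sigma_fixed_iff = normal_basis_facts(10)
lemmas gram = normal_basis_facts(11)

text \<open>The dual basis of \<open>B\<close> with respect to \<open>b\<close>.\<close>

definition dual :: "'v \<Rightarrow> 'v" where
  "dual y = (if \<sigma> y = y then y else \<sigma> y - (if C (level (\<sigma> y)) (level y) then y else 0))"

lemma form_dual:
  assumes z: "z \<in> B" and y: "y \<in> B"
  shows "b z (dual y) = (if z = y then 1 else 0)"
proof (cases "\<sigma> y = y")
  case True
  then have "y = \<sigma> z \<longleftrightarrow> z = y" using sigma_sigma z by metis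
  then show ?thesis using True gram[OF z y] by (auto simp: dual_def)
next
  case False
  have zy: "y = \<sigma> z \<longleftrightarrow> z = \<sigma> y" "\<sigma> y = \<sigma> z \<longleftrightarrow> z = y"
    using sigma_sigma z y by metis+
  have "\<not> (C (level (\<sigma> y)) (level y) \<and> C (level y) (level (\<sigma> y)))"
    using False sigma_fixed_iff[OF y] C_le by (metis le_antisym)
  moreover have "b z (\<sigma> y) = (if z = y \<or> z = \<sigma> y \<and> C (level (\<sigma> y)) (level y) then 1 else 0)"
    using gram[OF z sigma_B[OF y]] zy sigma_sigma[OF y] by auto
  moreover have "b z y = (if z = \<sigma> y \<or> z = y \<and> C (level y) (level (\<sigma> y)) then 1 else 0)"
    using gram[OF z y] zy by auto
  ultimately show ?thesis
    using False by (auto simp: dual_def form_simps)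
qed

text \<open>The correction by \<open>y\<close> occurs only if \<open>level y \<le> level (\<sigma> y)\<close>. This is why it matters that the
  non-isotropic vector of a pair is the one of higher level: the dual basis is then adapted to the flag
  with the levels given by \<open>\<sigma>\<close>.\<close>

lemma dual_mem_flag:
  assumes y: "y \<in> B" and "\<sigma> y \<in> F j"
  shows "dual y \<in> F j"
proof -
  have "y \<in> F j" if "C (level (\<sigma> y)) (level y)"
    using C_le[OF that] assms(2) by (simp add: mem_flag_iff)
  then show ?thesis
    using assms by (auto simp: dual_def intro: subspace_diff flag_subspace)
qed

lemma coefficient:
  assumes S: "S \<subseteq> B" and y: "y \<in> B"
  shows "b (\<Sum>x\<in>S. scale (c x) x) (dual y) = (if y \<in> S then c y else 0)"
proof -
  have fin: "finite S" using S finite_B by (rule finite_subset)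
  have "b (\<Sum>x\<in>S. scale (c x) x) (dual y) = (\<Sum>x\<in>S. if y = x then c x else 0)"
    unfolding form_sum_left form_scale_left
    using S y by (intro sum.cong) (auto simp: form_dual)
  then show ?thesis using fin by simp
qed

lemma independent_B: "independent B"
proof (rule independent_if_scalars_zero[OF finite_B])
  fix c x assume "(\<Sum>x\<in>B. scale (c x) x) = 0" "x \<in> B"
  then show "c x = 0" using coefficient[of B x c] by simp
qed

lemma independent_subset_B: "S \<subseteq> B \<Longrightarrow> independent S"
  using independent_B independent_mono by blast

lemma span_B_Int_flag: "span (B \<inter> F q) = F q"
proof
  show "span (B \<inter> F q) \<subseteq> F q" by (intro span_minimal flag_subspace) simp
  show "F q \<subseteq> span (B \<inter> F q)" using span_flag by blast
qed

lemma span_B: "span B = UNIV"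
proof -
  obtain N where "F N = UNIV" by (rule flag_whole)
  then show ?thesis using span_B_Int_flag[of N] by simp
qed

lemma orth_flag_B:
  assumes y: "y \<in> B" and r: "r < level (\<sigma> y)"
  shows "y \<in> orth b (F r)"
proof -
  have "b y z = 0" if "z \<in> B" "z \<in> F r" for z
    using gram[OF y that(1)] that(2) r C_le by (fastforce simp: mem_flag_iff)
  then have "B \<inter> F r \<subseteq> orth b {y}" by (auto simp: orth_def symmetric)
  then have "span (B \<inter> F r) \<subseteq> orth b {y}" by (intro span_minimal subspace_orth)
  then show ?thesis unfolding span_B_Int_flag by (auto simp: orth_def symmetric)
qed

text \<open>A vector that is orthogonal to \<open>F r\<close> is orthogonal to the dual basis vectors in \<open>F r\<close>, and these
  values are its coordinates.\<close>

lemma flag_Int_orth_flag: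
  "F q \<inter> orth b (F r) = span {y \<in> B. level y \<le> q \<and> r < level (\<sigma> y)}" (is "_ = span ?S")
proof
  show "span ?S \<subseteq> F q \<inter> orth b (F r)"
    by (intro span_minimal subspace_inter flag_subspace subspace_orth)
      (auto simp: mem_flag_iff orth_flag_B)
  show "F q \<inter> orth b (F r) \<subseteq> span ?S"
  proof
    fix v assume v: "v \<in> F q \<inter> orth b (F r)"
    let ?T = "B \<inter> F q"
    have fin: "finite ?T" using finite_B by simp
    have "v \<in> span ?T" using v span_B_Int_flag by blast
    then obtain c where c: "v = (\<Sum>x\<in>?T. scale (c x) x)"
      using span_finite[OF fin] by auto
    have "scale (c x) x \<in> span ?S" if x: "x \<in> ?T" for x
    proof (cases "r < level (\<sigma> x)")
      case True
      then show ?thesis using x by (intro span_scale span_base) (simp add: mem_flag_iff)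
    next
      case False
      then have "dual x \<in> F r" using x by (intro dual_mem_flag) (auto simp: mem_flag_iff)
      then have "b v (dual x) = 0" using v orthD by blast
      then have "c x = 0" using coefficient[of ?T x c] x c by simp
      then show ?thesis by (simp add: span_zero)
    qed
    then show "v \<in> span ?S" unfolding c by (rule span_sum)
  qed
qed

lemma n_inv_eq_card:
  assumes q: "1 \<le> q" and r: "1 \<le> r"
  shows "n_inv scale b F q r = card {y \<in> B. level y = q \<and> level (\<sigma> y) = r}"
proof -
  let ?U = "{y \<in> B. level y \<le> q \<and> r - 1 < level (\<sigma> y)}"
  let ?W1 = "{y \<in> B. level y \<le> q \<and> r < level (\<sigma> y)}"
  let ?W2 = "{y \<in> B. level y \<le> q - 1 \<and> r - 1 < level (\<sigma> y)}"
  have U: "num UNIV q r = span ?U" using flag_Int_orth_flag[of q "r - 1"] by (simp add: num_def)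
  have W: "den UNIV q r = span (?W1 \<union> ?W2)"
    using flag_Int_orth_flag[of q r] flag_Int_orth_flag[of "q - 1" "r - 1"]
    by (simp add: den_def span_Un_set_plus)
  have "dim (num UNIV q r) = card ?U" "dim (den UNIV q r) = card (?W1 \<union> ?W2)"
    unfolding U W by (intro dim_span_eq_card_independent independent_subset_B; blast)+
  then have "n_inv scale b F q r = card ?U - card (?W1 \<union> ?W2)" by (simp add: n_inv_eq_dim)
  also have "\<dots> = card (?U - (?W1 \<union> ?W2))"
    using finite_B by (intro card_Diff_subset[symmetric]) auto
  also have "?U - (?W1 \<union> ?W2) = {y \<in> B. level y = q \<and> level (\<sigma> y) = r}"
    using q r by auto
  finally show ?thesis .
qed

lemma level_ge_one:
  assumes "y \<in> B"
  shows "1 \<le> level y"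
proof (rule ccontr)
  assume "\<not> 1 \<le> level y"
  then have "y \<in> F 0" by (simp add: mem_flag_iff)
  then have "y = 0" using flag_zero by simp
  then show False using assms independent_B dependent_zero by blast
qed

lemma sigma_class: "\<sigma> ` {y \<in> B. level y = q \<and> level (\<sigma> y) = r} = {y \<in> B. level y = r \<and> level (\<sigma> y) = q}"
proof
  show "{y \<in> B. level y = r \<and> level (\<sigma> y) = q} \<subseteq> \<sigma> ` {y \<in> B. level y = q \<and> level (\<sigma> y) = r}"
  proof
    fix y assume "y \<in> {y \<in> B. level y = r \<and> level (\<sigma> y) = q}"
    then have "\<sigma> y \<in> {y \<in> B. level y = q \<and> level (\<sigma> y) = r}" "y = \<sigma> (\<sigma> y)"
      by (simp_all add: sigma_B sigma_sigma)
    then show "y \<in> \<sigma> ` {y \<in> B. level y = q \<and> level (\<sigma> y) = r}" by (rule rev_image_eqI)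
  qed
qed (auto simp: sigma_B sigma_sigma)

lemma inj_on_sigma: "inj_on \<sigma> B"
  using sigma_sigma by (metis inj_onI)

lemma upper_level:
  assumes "y \<in> B" and "level (\<sigma> y) < level y"
  shows "y \<in> R"
  using assms sigma_R_iff[of y] R_level[of "\<sigma> y"] sigma_sigma[of y] by force

end

section \<open>The block diagonal matrix\<close>

lemma matrix_of_form_append:
  assumes "\<And>x y. x \<in> set xs \<Longrightarrow> y \<in> set ys \<Longrightarrow> b x y = 0 \<and> b y x = 0"
  shows "matrix_of_form b (xs @ ys) =
    four_block_mat (matrix_of_form b xs) (0\<^sub>m (length xs) (length ys))
      (0\<^sub>m (length ys) (length xs)) (matrix_of_form b ys)"
  by (rule eq_matI) (use assms in \<open>auto simp: matrix_of_form_def nth_append\<close>)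

lemma dim_matrix_of_form [simp]:
  "dim_row (matrix_of_form b xs) = length xs" "dim_col (matrix_of_form b xs) = length xs"
  by (simp_all add: matrix_of_form_def)

lemma matrix_of_form_concat:
  assumes "sorted_wrt (\<lambda>xs ys. \<forall>x\<in>set xs. \<forall>y\<in>set ys. b x y = 0 \<and> b y x = 0) bs"
  shows "matrix_of_form b (concat bs) = diag_block_mat (map (matrix_of_form b) bs)"
  using assms
proof (induction bs)
  case Nil
  show ?case by (rule eq_matI) (simp_all add: matrix_of_form_def)
next
  case (Cons xs bs)
  have IH: "diag_block_mat (map (matrix_of_form b) bs) = matrix_of_form b (concat bs)"
    using Cons by simp
  have "matrix_of_form b (xs @ concat bs) =
    four_block_mat (matrix_of_form b xs) (0\<^sub>m (length xs) (length (concat bs)))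
      (0\<^sub>m (length (concat bs)) (length xs)) (matrix_of_form b (concat bs))"
    using Cons.prems by (intro matrix_of_form_append) auto
  then show ?case by (simp add: IH Let_def)
qed

lemma matrix_of_form_pair:
  "matrix_of_form b [x, y] = mat_of_rows_list 2 [[b x x, b x y], [b y x, b y y]]"
  by (rule eq_matI) (auto simp: matrix_of_form_def mat_of_rows_list_def less_Suc_eq numeral_2_eq_2)

lemma sum_card_fibres:
  assumes "finite S" and "finite T" and "g ` S \<subseteq> T"
  shows "(\<Sum>t\<in>T. card {x \<in> S. g x = t}) = card S"
  using sum.group[OF assms, of "\<lambda>_. 1 :: nat"] by simp

context normal_basis_of_space
begin

definition pairs :: "'v list \<Rightarrow> 'v list" where
  "pairs xs = concat (map (\<lambda>x. [\<sigma> x, x]) xs)"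

lemma set_pairs: "set (pairs xs) = set xs \<union> \<sigma> ` set xs"
  by (auto simp: pairs_def)

lemma distinct_pairs:
  assumes "distinct xs" and "set xs \<subseteq> R"
  shows "distinct (pairs xs)"
  using assms
proof (induction xs)
  case (Cons x xs)
  have x: "x \<in> R" "x \<in> B" using Cons.prems R_subset by auto
  have notin: "\<sigma> y \<notin> R" if "y \<in> R" for y
    using that sigma_R_iff[of y] R_not_fixed R_subset by blast
  have "x \<notin> \<sigma> ` set xs" using x notin Cons.prems by auto
  moreover have "\<sigma> x \<notin> set xs" using x notin Cons.prems by auto
  moreover have "\<sigma> x \<notin> \<sigma> ` set xs"
    using x Cons.prems R_subset inj_on_sigma by (auto dest: inj_onD)
  ultimately show ?case
    using Cons R_not_fixed[OF x(1)] set_pairs[of xs] by (auto simp: pairs_def)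
qed (simp add: pairs_def)

text \<open>A vector of a normal basis can pair nontrivially only with itself and its partner, so blocks closed
  under \<open>\<sigma>\<close> are orthogonal to each other as soon as they are disjoint.\<close>

lemma blocks_orthogonal:
  assumes "distinct (concat bs)"
    and "\<And>xs. xs \<in> set bs \<Longrightarrow> set xs \<subseteq> B \<and> \<sigma> ` set xs \<subseteq> set xs"
  shows "sorted_wrt (\<lambda>xs ys. \<forall>x\<in>set xs. \<forall>y\<in>set ys. b x y = 0 \<and> b y x = 0) bs"
  using assms
proof (induction bs)
  case (Cons xs bs)
  have "b x y = 0 \<and> b y x = 0" if "x \<in> set xs" "ys \<in> set bs" "y \<in> set ys" for x ys y
  proof -
    have "x \<in> B" "\<sigma> x \<in> set xs" using Cons.prems(2)[of xs] that by auto
    moreover have "y \<in> B" using Cons.prems(2)[of ys] that by auto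
    moreover have "set xs \<inter> set ys = {}" using Cons.prems(1) that by auto
    ultimately have "b x y = 0" using gram[of x y] that by auto
    then show ?thesis using symmetric[of x y] by simp
  qed
  then show ?case using Cons by auto
qed simp

text \<open>Together with their partners these vectors span the blocks \<open>M\<^sub>0\<close>.\<close>

definition off_corner :: "'v set" where
  "off_corner = {x \<in> R. \<not> C (level x) (level (\<sigma> x))}"

text \<open>Together with their partners these vectors span the blocks \<open>M\<^sub>1\<close>.\<close>

definition on_corner :: "'v set" where
  "on_corner = {x \<in> R. C (level x) (level (\<sigma> x))}"

definition fixed :: "'v set" where
  "fixed = {x \<in> B. \<sigma> x = x}"

lemma R_sigma_lower: "x \<in> R \<Longrightarrow> \<not> C (level (\<sigma> x)) (level x)"
  using C_le[of "level (\<sigma> x)" "level x"] R_level[of x] R_not_fixed[of x] R_subset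
    sigma_fixed_iff[of x] by (metis le_antisym subsetD)

lemma form_fixed: "x \<in> fixed \<Longrightarrow> y \<in> fixed \<Longrightarrow> b x y = (if x = y then 1 else 0)"
  using gram[of x y] by (auto simp: fixed_def)

lemma form_pair:
  assumes x: "x \<in> R"
  shows "b (\<sigma> x) (\<sigma> x) = 0" "b (\<sigma> x) x = 1" "b x (\<sigma> x) = 1"
    "b x x = (if C (level x) (level (\<sigma> x)) then 1 else 0)"
proof -
  have xB: "x \<in> B" "\<sigma> x \<in> B" "\<sigma> (\<sigma> x) = x"
    using x R_subset sigma_B sigma_sigma by auto
  show "b (\<sigma> x) (\<sigma> x) = 0" "b (\<sigma> x) x = 1" "b x (\<sigma> x) = 1"
    "b x x = (if C (level x) (level (\<sigma> x)) then 1 else 0)"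
    using gram[OF xB(2,2)] gram[OF xB(2,1)] gram[OF xB(1,2)] gram[OF xB(1,1)] xB(3)
      R_not_fixed[OF x] R_sigma_lower[OF x] by auto
qed

lemma coordinated_basis_blocks:
  "\<exists>es m. coordinated_basis F es \<and>
     matrix_of_form b es =
       diag_block_mat (replicate m M0 @ replicate (card on_corner) M1 @ [1\<^sub>m (card fixed)])"
proof -
  have fin: "finite R" using R_subset finite_B by (rule finite_subset)
  obtain xs where xs: "set xs = off_corner" "distinct xs"
    using finite_distinct_list[of off_corner] fin by (auto simp: off_corner_def)
  obtain ys where ys: "set ys = on_corner" "distinct ys"
    using finite_distinct_list[of on_corner] fin by (auto simp: on_corner_def)
  obtain ds where ds: "set ds = fixed" "distinct ds"
    using finite_distinct_list[of "fixed"] finite_B by (auto simp: fixed_def)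
  define bs where "bs = map (\<lambda>x. [\<sigma> x, x]) (xs @ ys) @ [ds]"
  have R: "off_corner \<union> on_corner = R" "off_corner \<inter> on_corner = {}"
    by (auto simp: off_corner_def on_corner_def)
  have concat: "concat bs = pairs (xs @ ys) @ ds" by (simp add: bs_def pairs_def)
  have "set (pairs (xs @ ys)) = R \<union> \<sigma> ` R" using xs ys R by (auto simp: set_pairs)
  moreover have "R \<union> \<sigma> ` R \<union> fixed = B"
  proof
    show "R \<union> \<sigma> ` R \<union> fixed \<subseteq> B" using R_subset sigma_B by (auto simp: fixed_def)
    show "B \<subseteq> R \<union> \<sigma> ` R \<union> fixed"
    proof
      fix x assume x: "x \<in> B"
      have "x = \<sigma> (\<sigma> x)" using sigma_sigma[OF x] by simp
      then have "\<sigma> x \<in> R \<Longrightarrow> x \<in> \<sigma> ` R" by (rule image_eqI)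
      then show "x \<in> R \<union> \<sigma> ` R \<union> fixed"
        using x sigma_R_iff[OF x] by (cases "\<sigma> x = x") (auto simp: fixed_def)
    qed
  qed
  ultimately have set_es: "set (concat bs) = B" using ds by (simp add: concat)
  have "(R \<union> \<sigma> ` R) \<inter> fixed = {}"
  proof -
    have "\<sigma> (\<sigma> x) \<noteq> \<sigma> x" if "x \<in> R" for x
      using sigma_sigma[of x] R_subset R_not_fixed[OF that] that by auto
    then show ?thesis using R_not_fixed by (auto simp: fixed_def)
  qed
  then have dist: "distinct (concat bs)"
    using xs ys ds R \<open>set (pairs (xs @ ys)) = R \<union> \<sigma> ` R\<close>
    by (simp add: concat distinct_pairs)
  have "sorted_wrt (\<lambda>xs ys. \<forall>x\<in>set xs. \<forall>y\<in>set ys. b x y = 0 \<and> b y x = 0) bs"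
  proof (rule blocks_orthogonal[OF dist])
    fix zs assume zs: "zs \<in> set bs"
    then have "set zs \<subseteq> B" using set_es by auto
    moreover have "\<sigma> ` set zs \<subseteq> set zs"
    proof (cases "zs = ds")
      case True
      then show ?thesis using ds by (auto simp: fixed_def)
    next
      case False
      then obtain x where "zs = [\<sigma> x, x]" using zs by (auto simp: bs_def)
      then show ?thesis using \<open>set zs \<subseteq> B\<close> by (auto simp: sigma_sigma)
    qed
    ultimately show "set zs \<subseteq> B \<and> \<sigma> ` set zs \<subseteq> set zs" by blast
  qed
  then have "matrix_of_form b (concat bs) = diag_block_mat (map (matrix_of_form b) bs)"
    by (rule matrix_of_form_concat)
  also have "map (matrix_of_form b) bs =
    replicate (length xs) M0 @ replicate (length ys) M1 @ [1\<^sub>m (length ds)]"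
  proof -
    have "map (\<lambda>x. matrix_of_form b [\<sigma> x, x]) xs = map (\<lambda>_. M0) xs"
      using xs form_pair by (intro map_cong) (auto simp: off_corner_def matrix_of_form_pair M0_def)
    moreover have "map (\<lambda>x. matrix_of_form b [\<sigma> x, x]) ys = map (\<lambda>_. M1) ys"
      using ys form_pair by (intro map_cong) (auto simp: on_corner_def matrix_of_form_pair M1_def)
    moreover have "matrix_of_form b ds = 1\<^sub>m (length ds)"
    proof (rule eq_matI)
      fix i j assume "i < dim_row (1\<^sub>m (length ds) :: 'k mat)" "j < dim_col (1\<^sub>m (length ds) :: 'k mat)"
      then have ij: "i < length ds" "j < length ds" by simp_all
      then have "ds ! i \<in> fixed" "ds ! j \<in> fixed" using ds(1) nth_mem by blast+
      then show "matrix_of_form b ds $$ (i, j) = 1\<^sub>m (length ds) $$ (i, j)"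
        using ij by (simp add: matrix_of_form_def form_fixed nth_eq_iff_index_eq[OF ds(2)])
    qed simp_all
    ultimately show ?thesis by (simp add: bs_def map_replicate_const comp_def)
  qed
  finally have "matrix_of_form b (concat bs) = diag_block_mat
    (replicate (length xs) M0 @ replicate (card on_corner) M1 @ [1\<^sub>m (card fixed)])"
    using ys ds distinct_card[of ys] distinct_card[of ds] by simp
  moreover have "coordinated_basis F (concat bs)"
    unfolding coordinated_basis_def basis_of_def set_es
    using dist independent_B span_B span_B_Int_flag independent_subset_B by auto
  ultimately show ?thesis by blast
qed

lemma finite_classes: "finite {(q, r). 1 \<le> q \<and> 1 \<le> r \<and> n_inv scale b F q r \<noteq> 0}"
proof (rule finite_subset)
  show "{(q, r). 1 \<le> q \<and> 1 \<le> r \<and> n_inv scale b F q r \<noteq> 0} \<subseteq> (\<lambda>y. (level y, level (\<sigma> y))) ` B"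
  proof
    fix t assume "t \<in> {(q, r). 1 \<le> q \<and> 1 \<le> r \<and> n_inv scale b F q r \<noteq> 0}"
    then obtain q r where t: "t = (q, r)" and "1 \<le> q" "1 \<le> r" "n_inv scale b F q r \<noteq> 0"
      by blast
    then have "{y \<in> B. level y = q \<and> level (\<sigma> y) = r} \<noteq> {}"
      using n_inv_eq_card by (metis card.empty)
    then show "t \<in> (\<lambda>y. (level y, level (\<sigma> y))) ` B" unfolding t by force
  qed
qed (use finite_B in simp)

lemma n_inv_nonzero:
  assumes "y \<in> B"
  shows "n_inv scale b F (level y) (level (\<sigma> y)) \<noteq> 0"
proof -
  let ?S = "{z \<in> B. level z = level y \<and> level (\<sigma> z) = level (\<sigma> y)}"
  have "y \<in> ?S" "finite ?S" using assms finite_B by auto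
  then have "card ?S \<noteq> 0" by (metis card_0_eq empty_iff)
  then show ?thesis
    using n_inv_eq_card[of "level y" "level (\<sigma> y)"] level_ge_one assms sigma_B by simp
qed

lemma card_fixed_eq_sum:
  "(\<Sum>q | 1 \<le> q \<and> n_inv scale b F q q \<noteq> 0. n_inv scale b F q q * (if C q q then 1 else 0)) =
    card fixed" (is "sum _ ?T = _")
proof -
  have "?T \<subseteq> fst ` {(q, r). 1 \<le> q \<and> 1 \<le> r \<and> n_inv scale b F q r \<noteq> 0}" by force
  then have fin: "finite ?T" using finite_classes by (meson finite_imageI finite_subset)
  have "n_inv scale b F q q * (if C q q then 1 else 0) = card {x \<in> fixed. level x = q}"
    if q: "1 \<le> q" for q
  proof (cases "C q q")
    case True
    have "{x \<in> fixed. level x = q} = {x \<in> B. level x = q \<and> level (\<sigma> x) = q}"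
      using True sigma_fixed_iff by (auto simp: fixed_def)
    then show ?thesis using True n_inv_eq_card[OF q q] by simp
  next
    case False
    then have "\<not> (x \<in> fixed \<and> level x = q)" for x
      using sigma_fixed_iff[of x] by (auto simp: fixed_def)
    then have "{x \<in> fixed. level x = q} = {}" by blast
    then show ?thesis using False by (simp only: card.empty if_False)
  qed
  then have "(\<Sum>q\<in>?T. n_inv scale b F q q * (if C q q then 1 else 0)) =
      (\<Sum>q\<in>?T. card {x \<in> fixed. level x = q})"
    by (intro sum.cong) auto
  also have "\<dots> = card fixed"
  proof (rule sum_card_fibres[OF _ fin])
    show "finite fixed" using finite_B by (simp add: fixed_def)
    show "level ` fixed \<subseteq> ?T"
      using level_ge_one n_inv_nonzero by (force simp: fixed_def)
  qed
  finally show ?thesis .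
qed

text \<open>A vector of \<open>R\<close> on a corner has level \<open>r\<close> strictly above the level \<open>q\<close> of its partner, as equal levels
  would make it a fixed point. So it is the partners that \<open>n\<^sub>q\<^sub>r\<close> with \<open>q < r\<close> counts.\<close>

lemma card_on_corner_eq_sum:
  "(\<Sum>(q, r) | 1 \<le> q \<and> q < r \<and> n_inv scale b F q r \<noteq> 0.
      n_inv scale b F q r * (if C r q then 1 else 0)) = card on_corner" (is "sum _ ?T = _")
proof -
  have "?T \<subseteq> {(q, r). 1 \<le> q \<and> 1 \<le> r \<and> n_inv scale b F q r \<noteq> 0}" by auto
  then have fin: "finite ?T" using finite_classes by (rule finite_subset)
  let ?k = "\<lambda>x. (level (\<sigma> x), level x)"
  have "n_inv scale b F q r * (if C r q then 1 else 0) = card {x \<in> on_corner. ?k x = (q, r)}"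
    if qr: "1 \<le> q" "q < r" for q r
  proof (cases "C r q")
    case True
    have "x \<in> R" if "x \<in> B" "level x = r" "level (\<sigma> x) = q" for x
      using upper_level[OF that(1)] that qr by simp
    then have "{x \<in> on_corner. ?k x = (q, r)} = {x \<in> B. level x = r \<and> level (\<sigma> x) = q}"
      using True R_subset by (auto simp: on_corner_def)
    also have "\<dots> = \<sigma> ` {x \<in> B. level x = q \<and> level (\<sigma> x) = r}" by (rule sigma_class[symmetric])
    also have "card \<dots> = card {x \<in> B. level x = q \<and> level (\<sigma> x) = r}"
      by (intro card_image inj_on_subset[OF inj_on_sigma]) blast
    also have "\<dots> = n_inv scale b F q r" using n_inv_eq_card[of q r] qr by simp
    finally show ?thesis using True by simp
  next
    case False
    then have "{x \<in> on_corner. ?k x = (q, r)} = {}" by (auto simp: on_corner_def)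
    then show ?thesis using False by (simp only: card.empty if_False)
  qed
  then have "(\<Sum>(q, r)\<in>?T. n_inv scale b F q r * (if C r q then 1 else 0)) =
      (\<Sum>t\<in>?T. card {x \<in> on_corner. ?k x = t})"
    by (intro sum.cong) auto
  also have "\<dots> = card on_corner"
  proof (rule sum_card_fibres[OF _ fin])
    show "finite on_corner" using finite_B R_subset by (auto simp: on_corner_def intro: finite_subset)
    show "?k ` on_corner \<subseteq> ?T"
    proof
      fix t assume "t \<in> ?k ` on_corner"
      then obtain x where t: "t = ?k x" and x: "x \<in> R" "C (level x) (level (\<sigma> x))"
        by (auto simp: on_corner_def)
      have xB: "x \<in> B" "\<sigma> x \<in> B" "\<sigma> (\<sigma> x) = x"
        using x R_subset sigma_B sigma_sigma by auto
      have "level (\<sigma> x) \<noteq> level x"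
        using x R_not_fixed[of x] sigma_fixed_iff[OF xB(1)] by auto
      then have "level (\<sigma> x) < level x" using R_level[OF x(1)] by simp
      then show "t \<in> ?T"
        using t level_ge_one[OF xB(2)] n_inv_nonzero[OF xB(2)] xB(3) by simp
    qed
  qed
  finally show ?thesis .
qed

end

context perfect_char_two_flagged_space
begin

lemma corner_normal_basis:
  obtains B \<sigma> R where "normal_basis_of_space scale b F (corner UNIV) B \<sigma> R"
proof -
  have "\<exists>B \<sigma> R. normal_basis (corner UNIV) UNIV B \<sigma> R"
    by (rule normal_basis_exists[OF corner_le flag_summand_UNIV refl])
  then obtain B \<sigma> R where "normal_basis (corner UNIV) UNIV B \<sigma> R" by (elim exE)
  then have "normal_basis_of_space scale b F (corner UNIV) B \<sigma> R"
    by unfold_locales (rule corner_le)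
  then show ?thesis by (rule that)
qed

lemma diagonal_block_basis:
  "\<exists>es m. coordinated_basis F es \<and>
     matrix_of_form b es =
       diag_block_mat (replicate m M0 @ replicate (num_M1 scale b F) M1 @
         [1\<^sub>m (size_one scale b F)])"
proof -
  obtain B \<sigma> R where "normal_basis_of_space scale b F (corner UNIV) B \<sigma> R"
    by (rule corner_normal_basis)
  then interpret N: normal_basis_of_space scale b F "corner UNIV" B \<sigma> R .
  have "size_one scale b F = card N.fixed" "num_M1 scale b F = card N.on_corner"
    unfolding size_one_def num_M1_def n1_inv_eq_corner
    by (rule N.card_fixed_eq_sum N.card_on_corner_eq_sum)+
  then show ?thesis using N.coordinated_basis_blocks by simp
qed

end

section \<open>Equivalence of triples\<close>

lemma bij_betw_respecting_fibres:
  assumes A: "finite A" and A': "finite A'"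
    and card: "\<And>c. card {x \<in> A. k x = c} = card {x \<in> A'. k' x = c}"
  obtains \<phi> where "bij_betw \<phi> A A'" "\<forall>x\<in>A. k' (\<phi> x) = k x"
proof -
  have "\<exists>h. bij_betw h {x \<in> A. k x = c} {x \<in> A'. k' x = c}" for c
    using A A' card by (intro finite_same_card_bij) auto
  then obtain h where h: "\<And>c. bij_betw (h c) {x \<in> A. k x = c} {x \<in> A'. k' x = c}" by metis
  define \<phi> where "\<phi> x = h (k x) x" for x
  have mem: "\<phi> x \<in> A'" "k' (\<phi> x) = k x" if "x \<in> A" for x
    using bij_betwE[OF h[of "k x"]] that by (auto simp: \<phi>_def)
  have "bij_betw \<phi> A A'"
  proof (rule bij_betw_imageI)
    show "inj_on \<phi> A"
    proof (rule inj_onI)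
      fix x y assume xy: "x \<in> A" "y \<in> A" "\<phi> x = \<phi> y"
      then have "k x = k y" using mem by metis
      then show "x = y"
        using xy bij_betw_imp_inj_on[OF h[of "k x"]] by (auto simp: \<phi>_def inj_on_def)
    qed
    show "\<phi> ` A = A'"
    proof
      show "A' \<subseteq> \<phi> ` A"
      proof
        fix y assume "y \<in> A'"
        then have "y \<in> h (k' y) ` {x \<in> A. k x = k' y}"
          using bij_betw_imp_surj_on[OF h[of "k' y"]] by simp
        then obtain x where "x \<in> A" "k x = k' y" "y = h (k' y) x" by blast
        then have "x \<in> A" "y = \<phi> x" by (simp_all add: \<phi>_def)
        then show "y \<in> \<phi> ` A" by blast
      qed
    qed (use mem in auto)
  qed
  then show ?thesis using mem(2) by (intro that ballI)
qed

context normal_basis_of_space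
begin

text \<open>One vector from each orbit of \<open>\<sigma>\<close>.\<close>

definition upper :: "'v set" where
  "upper = {y \<in> B. \<sigma> y = y} \<union> R"

lemma upper_subset: "upper \<subseteq> B"
  using R_subset by (auto simp: upper_def)

lemma upper_sigma_iff: "y \<in> B \<Longrightarrow> \<sigma> y \<noteq> y \<Longrightarrow> \<sigma> y \<in> upper \<longleftrightarrow> y \<notin> upper"
  using sigma_R_iff[of y] sigma_sigma[of y] by (auto simp: upper_def)

lemma upper_class:
  assumes r: "r \<le> q" and C: "r = q \<Longrightarrow> C q q"
  shows "{y \<in> upper. level y = q \<and> level (\<sigma> y) = r} = {y \<in> B. level y = q \<and> level (\<sigma> y) = r}"
proof -
  have "y \<in> upper" if "y \<in> B" "level y = q" "level (\<sigma> y) = r" for y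
  proof (cases "r = q")
    case True
    then have "\<sigma> y = y" using sigma_fixed_iff[OF that(1)] that C by simp
    then show ?thesis using that by (simp add: upper_def)
  next
    case False
    then show ?thesis using upper_level[OF that(1)] that r by (auto simp: upper_def)
  qed
  then show ?thesis using upper_subset by blast
qed

text \<open>Which orbits have levels \<open>q\<close> and \<open>r\<close> is determined by the invariants. For \<open>q = r\<close> the predicate \<open>C\<close>
  decides whether all vectors of the class are fixed points or all of them have a distinct partner in
  the same class, which explains the division by \<open>2\<close>.\<close>

lemma card_upper_class:
  assumes q: "1 \<le> q" and r: "1 \<le> r"
  shows "card {y \<in> upper. level y = q \<and> level (\<sigma> y) = r} =
    (if q < r then 0
     else if r = q \<and> \<not> C q q then n_inv scale b F q q div 2
     else n_inv scale b F q r)"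
proof -
  let ?U = "{y \<in> upper. level y = q \<and> level (\<sigma> y) = r}"
  consider "q < r" | "r = q" "\<not> C q q" | "r \<le> q" "r = q \<longrightarrow> C q q" by linarith
  then show ?thesis
  proof cases
    case 1
    then have "\<not> (y \<in> upper \<and> level y = q \<and> level (\<sigma> y) = r)" for y
      using R_level[of y] unfolding upper_def by auto
    then have "?U = {}" by blast
    then show ?thesis using 1 by (simp only: card.empty if_True)
  next
    case 2
    let ?B = "{y \<in> B. level y = q \<and> level (\<sigma> y) = q}"
    have not_fixed: "\<sigma> y \<noteq> y" if "y \<in> ?B" for y
      using that sigma_fixed_iff[of y] 2 by auto
    have U: "?U \<subseteq> ?B" using upper_subset 2 by blast
    have split: "?B = ?U \<union> \<sigma> ` ?U"
    proof
      show "?B \<subseteq> ?U \<union> \<sigma> ` ?U"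
      proof
        fix y assume y: "y \<in> ?B"
        show "y \<in> ?U \<union> \<sigma> ` ?U"
        proof (cases "y \<in> upper")
          case False
          then have "\<sigma> y \<in> ?U"
            using y upper_sigma_iff[of y] not_fixed[OF y] 2 by (simp add: sigma_sigma)
          moreover have "y = \<sigma> (\<sigma> y)" using y by (simp add: sigma_sigma)
          ultimately show ?thesis by blast
        qed (use y 2 in simp)
      qed
      show "?U \<union> \<sigma> ` ?U \<subseteq> ?B" using U 2 by (auto simp: sigma_B sigma_sigma)
    qed
    have disj: "?U \<inter> \<sigma> ` ?U = {}"
    proof -
      have "\<sigma> y \<notin> upper" if "y \<in> ?U" for y
        using that U not_fixed[of y] upper_sigma_iff[of y] by blast
      then show ?thesis by blast
    qed
    have inj: "card (\<sigma> ` ?U) = card ?U"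
      using U by (intro card_image inj_on_subset[OF inj_on_sigma]) blast
    have "finite ?B" using finite_B by simp
    then have fin: "finite ?U" using U by (rule rev_finite_subset)
    have "card ?B = card ?U + card (\<sigma> ` ?U)"
      unfolding split by (rule card_Un_disjoint[OF fin finite_imageI[OF fin] disj])
    then have "n_inv scale b F q q = card ?U + card ?U"
      unfolding inj n_inv_eq_card[OF q q] .
    then show ?thesis using 2 by (simp only:) simp
  next
    case 3
    then have "?U = {y \<in> B. level y = q \<and> level (\<sigma> y) = r}" by (intro upper_class) auto
    then have "card ?U = n_inv scale b F q r" using n_inv_eq_card[OF q r] by simp
    moreover have "\<not> q < r" "\<not> (r = q \<and> \<not> C q q)" using 3 by auto
    ultimately show ?thesis by (simp only: if_False)
  qed
qed

end

text \<open>The invariants give a bijection between the chosen representatives of the orbits that preserves the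
  levels of a vector and of its partner. Commuting with the involutions, it extends to the bases in
  exactly one way.\<close>

lemma sigma_equivariant_bijection:
  assumes "normal_basis_of_space scale b F C B \<sigma> R"
    and "normal_basis_of_space scale' b' F' C' B' \<sigma>' R'"
    and n: "\<And>q r. 1 \<le> q \<Longrightarrow> 1 \<le> r \<Longrightarrow> n_inv scale b F q r = n_inv scale' b' F' q r"
    and C: "\<And>q r. 1 \<le> q \<Longrightarrow> 1 \<le> r \<Longrightarrow> C q r = C' q r"
  obtains \<psi> where "bij_betw \<psi> B B'"
    "\<forall>x\<in>B. flagged_space.level F' (\<psi> x) = flagged_space.level F x"
    "\<forall>x\<in>B. \<psi> (\<sigma> x) = \<sigma>' (\<psi> x)"
proof -
  interpret N: normal_basis_of_space scale b F C B \<sigma> R by fact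
  interpret N': normal_basis_of_space scale' b' F' C' B' \<sigma>' R' by fact
  let ?k = "\<lambda>x. (N.level x, N.level (\<sigma> x))" and ?k' = "\<lambda>x. (N'.level x, N'.level (\<sigma>' x))"
  have fin: "finite N.upper" "finite N'.upper"
    using N.upper_subset N.finite_B N'.upper_subset N'.finite_B by (auto intro: finite_subset)
  have classes: "card {x \<in> N.upper. ?k x = c} = card {x \<in> N'.upper. ?k' x = c}" for c
  proof (cases "1 \<le> fst c \<and> 1 \<le> snd c")
    case True
    then show ?thesis
      using N.card_upper_class[of "fst c" "snd c"] N'.card_upper_class[of "fst c" "snd c"] n C
      by (simp add: prod_eq_iff)
  next
    case False
    have "?k x \<noteq> c" if "x \<in> N.upper" for x
      using that N.upper_subset N.level_ge_one[of x] N.level_ge_one[of "\<sigma> x"] N.sigma_B False by auto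
    moreover have "?k' x \<noteq> c" if "x \<in> N'.upper" for x
      using that N'.upper_subset N'.level_ge_one[of x] N'.level_ge_one[of "\<sigma>' x"] N'.sigma_B False
      by auto
    ultimately have "{x \<in> N.upper. ?k x = c} = {}" "{x \<in> N'.upper. ?k' x = c} = {}" by blast+
    then show ?thesis by (simp only: card.empty)
  qed
  obtain \<phi> where \<phi>: "bij_betw \<phi> N.upper N'.upper" "\<forall>x\<in>N.upper. ?k' (\<phi> x) = ?k x"
    by (rule bij_betw_respecting_fibres[OF fin classes])
  have \<phi>_mem: "\<phi> x \<in> N'.upper" "\<phi> x \<in> B'" if "x \<in> N.upper" for x
    using bij_betwE[OF \<phi>(1)] that N'.upper_subset by auto
  have \<phi>_level: "N'.level (\<phi> x) = N.level x" "N'.level (\<sigma>' (\<phi> x)) = N.level (\<sigma> x)"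
    if "x \<in> N.upper" for x
    using bspec[OF \<phi>(2) that] by auto
  have \<phi>_fixed: "\<sigma>' (\<phi> x) = \<phi> x \<longleftrightarrow> \<sigma> x = x" if x: "x \<in> N.upper" for x
  proof -
    have xB: "x \<in> B" using x N.upper_subset by blast
    show ?thesis
      using N'.sigma_fixed_iff[OF \<phi>_mem(2)[OF x]] N.sigma_fixed_iff[OF xB] \<phi>_level[OF x]
        C[of "N.level x" "N.level x"] N.level_ge_one[OF xB] by simp
  qed
  define \<psi> where "\<psi> x = (if x \<in> N.upper then \<phi> x else \<sigma>' (\<phi> (\<sigma> x)))" for x
  have lower: "\<sigma> x \<in> N.upper" "\<sigma> x \<noteq> x" if "x \<in> B" "x \<notin> N.upper" for x
    using that N.upper_sigma_iff[of x] by (auto simp: N.upper_def)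
  have lower': "\<sigma>' (\<phi> (\<sigma> x)) \<notin> N'.upper" if x: "x \<in> B" "x \<notin> N.upper" for x
  proof -
    have "\<sigma> (\<sigma> x) \<noteq> \<sigma> x" using N.sigma_sigma[OF x(1)] lower[OF x] by simp
    then have "\<sigma>' (\<phi> (\<sigma> x)) \<noteq> \<phi> (\<sigma> x)" using \<phi>_fixed lower[OF x] by blast
    then show ?thesis using N'.upper_sigma_iff \<phi>_mem lower[OF x] by blast
  qed
  have \<psi>_mem: "\<psi> x \<in> B'" if "x \<in> B" for x
    using that \<phi>_mem lower N'.sigma_B by (auto simp: \<psi>_def)
  have \<psi>_level: "N'.level (\<psi> x) = N.level x" if "x \<in> B" for x
    using that \<phi>_level lower N.sigma_sigma by (auto simp: \<psi>_def)
  have \<psi>_\<sigma>: "\<psi> (\<sigma> x) = \<sigma>' (\<psi> x)" if x: "x \<in> B" for x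
  proof (cases "x \<in> N.upper")
    case True
    show ?thesis
    proof (cases "\<sigma> x = x")
      case fixed: True
      then show ?thesis using True \<phi>_fixed[OF True] by (simp add: \<psi>_def)
    next
      case False
      then have "\<sigma> x \<notin> N.upper" using N.upper_sigma_iff[OF x] True by simp
      then show ?thesis using True N.sigma_sigma[OF x] by (simp add: \<psi>_def)
    qed
  next
    case False
    then show ?thesis
      using lower[OF x False] N'.sigma_sigma[OF \<phi>_mem(2)] by (simp add: \<psi>_def)
  qed
  have "bij_betw \<psi> B B'"
  proof (rule bij_betw_imageI)
    have inj_\<phi>: "inj_on \<phi> N.upper" using \<phi>(1) by (rule bij_betw_imp_inj_on)
    show "inj_on \<psi> B"
    proof (rule inj_onI)
      fix x y assume x: "x \<in> B" and y: "y \<in> B" and eq: "\<psi> x = \<psi> y"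
      show "x = y"
      proof (cases "x \<in> N.upper")
        case True
        have "y \<in> N.upper"
        proof (rule ccontr)
          assume "y \<notin> N.upper"
          then show False using eq True \<phi>_mem(1)[OF True] lower'[OF y] by (simp add: \<psi>_def)
        qed
        then show ?thesis using True eq inj_onD[OF inj_\<phi>] by (simp add: \<psi>_def)
      next
        case False
        have yn: "y \<notin> N.upper"
        proof
          assume "y \<in> N.upper"
          then show False using eq False \<phi>_mem(1) lower'[OF x] by (metis \<psi>_def)
        qed
        have "\<phi> (\<sigma> x) = \<phi> (\<sigma> y)"
          using eq False yn N'.sigma_sigma[OF \<phi>_mem(2)] lower[OF x False] lower[OF y yn]
          by (metis \<psi>_def)
        then have "\<sigma> x = \<sigma> y"
          using inj_onD[OF inj_\<phi>] lower[OF x False] lower[OF y yn] by blast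
        then show ?thesis using N.sigma_sigma x y by metis
      qed
    qed
    show "\<psi> ` B = B'"
    proof
      show "\<psi> ` B \<subseteq> B'" using \<psi>_mem by blast
      show "B' \<subseteq> \<psi> ` B"
      proof
        fix y assume y: "y \<in> B'"
        have onto: "z \<in> \<psi> ` B" if "z \<in> N'.upper" for z
        proof -
          have "z \<in> \<phi> ` N.upper" unfolding bij_betw_imp_surj_on[OF \<phi>(1)] by (rule that)
          then obtain x where "x \<in> N.upper" "z = \<phi> x" by blast
          then show ?thesis using N.upper_subset by (auto simp: \<psi>_def)
        qed
        show "y \<in> \<psi> ` B"
        proof (cases "y \<in> N'.upper")
          case False
          then have "\<sigma>' y \<in> N'.upper"
            using y N'.upper_sigma_iff[of y] by (auto simp: N'.upper_def)
          then obtain x where x: "x \<in> B" "\<sigma>' y = \<psi> x" using onto by blast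
          then have "y = \<psi> (\<sigma> x)" using \<psi>_\<sigma>[OF x(1)] N'.sigma_sigma[OF y] by simp
          then show ?thesis using N.sigma_B[OF x(1)] by blast
        qed (use onto in blast)
      qed
    qed
  qed
  then show ?thesis using \<psi>_level \<psi>_\<sigma> by (intro that ballI)
qed

lemma equivalent_if_normal_bases_correspond:
  assumes "normal_basis_of_space scale b F C B \<sigma> R"
    and "normal_basis_of_space scale' b' F' C' B' \<sigma>' R'"
    and C: "\<And>q r. 1 \<le> q \<Longrightarrow> 1 \<le> r \<Longrightarrow> C q r = C' q r"
    and \<psi>: "bij_betw \<psi> B B'"
    and level_eq: "\<forall>x\<in>B. flagged_space.level F' (\<psi> x) = flagged_space.level F x"
    and \<sigma>_eq: "\<forall>x\<in>B. \<psi> (\<sigma> x) = \<sigma>' (\<psi> x)"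
  shows "equivalent_triples scale b F scale' b' F'"
proof -
  interpret N: normal_basis_of_space scale b F C B \<sigma> R by fact
  interpret N': normal_basis_of_space scale' b' F' C' B' \<sigma>' R' by fact
  interpret P: vector_space_pair scale scale' by unfold_locales
  note level = bspec[OF level_eq] and \<sigma> = bspec[OF \<sigma>_eq]
  obtain f where f: "Vector_Spaces.linear scale scale' f" and f\<psi>: "\<And>x. x \<in> B \<Longrightarrow> f x = \<psi> x"
    using P.linear_independent_extend[OF N.independent_B] by metis
  interpret f: Vector_Spaces.linear scale scale' f by (rule f)
  have inj_\<psi>: "inj_on \<psi> B" using \<psi> by (rule bij_betw_imp_inj_on)
  have fB: "f ` B = B'" using f\<psi> bij_betw_imp_surj_on[OF \<psi>] by (metis image_cong)
  have "inj_on f B" using inj_\<psi> f\<psi> by (metis inj_on_cong)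
  then have "inj_on f (N.span B)"
    using P.linear_inj_on_span_independent_image[OF f] fB N'.independent_B by metis
  moreover have "f ` N.span B = N'.span B'" using P.linear_span_image[OF f, of B] fB by metis
  ultimately have bij: "bij f" by (simp add: N.span_B N'.span_B bij_def)
  have flag: "f ` F j = F' j" for j
  proof -
    have "f ` (B \<inter> F j) = B' \<inter> F' j"
    proof
      show "f ` (B \<inter> F j) \<subseteq> B' \<inter> F' j"
        using fB f\<psi> level by (auto simp: N.mem_flag_iff N'.mem_flag_iff)
      show "B' \<inter> F' j \<subseteq> f ` (B \<inter> F j)"
      proof
        fix y assume y: "y \<in> B' \<inter> F' j"
        then obtain x where x: "x \<in> B" "y = f x" using fB by blast
        then have "x \<in> F j" using y f\<psi>[OF x(1)] level[OF x(1)]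
          by (simp add: N.mem_flag_iff N'.mem_flag_iff)
        then show "y \<in> f ` (B \<inter> F j)" using x by blast
      qed
    qed
    then show ?thesis
      using P.linear_span_image[OF f, of "B \<inter> F j"] N.span_B_Int_flag N'.span_B_Int_flag by metis
  qed
  have basis: "b' (f x) (f y) = b x y" if x: "x \<in> B" and y: "y \<in> B" for x y
  proof -
    have \<psi>B: "\<psi> x \<in> B'" "\<psi> y \<in> B'" using x y bij_betwE[OF \<psi>] by auto
    have "\<psi> y = \<sigma>' (\<psi> x) \<longleftrightarrow> y = \<sigma> x"
      using \<sigma>[OF x] inj_onD[OF inj_\<psi> _ y N.sigma_B[OF x]] by auto
    moreover have "\<psi> y = \<psi> x \<longleftrightarrow> y = x" using inj_onD[OF inj_\<psi> _ y x] by auto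
    moreover have "N'.level (\<sigma>' (\<psi> x)) = N.level (\<sigma> x)"
      using \<sigma>[OF x] level[OF N.sigma_B[OF x]] by simp
    moreover have "C (N.level x) (N.level (\<sigma> x)) = C' (N.level x) (N.level (\<sigma> x))"
      using C N.level_ge_one x N.sigma_B by blast
    ultimately show ?thesis
      using N.gram[OF x y] N'.gram[OF \<psi>B] f\<psi>[OF x] f\<psi>[OF y] level[OF x] by simp
  qed
  have "b' (f x) (f y) = b x y" for x y
  proof -
    have left: "b' (f x) (f y) = b x y" if y: "y \<in> B" for x y
    proof -
      have "x \<in> N.span B" by (simp add: N.span_B)
      then show ?thesis
        by (induction rule: N.span_induct_alt)
          (use basis y in \<open>simp_all add: f.add f.scale f.zero N.form_simps N'.form_simps\<close>)
    qed
    have "y \<in> N.span B" by (simp add: N.span_B)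
    then show ?thesis
      by (induction rule: N.span_induct_alt)
        (use left in \<open>simp_all add: f.add f.scale f.zero N.form_simps N'.form_simps\<close>)
  qed
  then show ?thesis
    unfolding equivalent_triples_def using f bij flag by blast
qed

text \<open>An equivalence carries numerators and denominators to each other; the dimensions and the corners, which
  determine the invariants, are therefore the same.\<close>

lemma equivalent_imp_invariants_eq:
  assumes "perfect_char_two_flagged_space scale b F"
    and "perfect_char_two_flagged_space scale' b' F'"
    and "equivalent_triples scale b F scale' b' F'"
  shows "n_inv scale b F q r = n_inv scale' b' F' q r"
    and "n1_inv scale b F q r = n1_inv scale' b' F' q r"
proof -
  interpret N: perfect_char_two_flagged_space scale b F by fact
  interpret N': perfect_char_two_flagged_space scale' b' F' by fact
  interpret P: finite_dimensional_vector_space_pair_1 scale N.some_basis scale'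
    by unfold_locales
  obtain f where f: "Vector_Spaces.linear scale scale' f" "bij f"
    and flag: "\<And>j. f ` F j = F' j" and form: "\<And>x y. b' (f x) (f y) = b x y"
    using assms(3) unfolding equivalent_triples_def by blast
  interpret f: Vector_Spaces.linear scale scale' f by (rule f)
  have inj: "inj f" and surj: "surj f" using f(2) by (auto simp: bij_def)
  have orth: "f ` orth b (F r) = orth b' (F' r)" for r
  proof
    show "f ` orth b (F r) \<subseteq> orth b' (F' r)"
      by (auto simp: orth_def form simp flip: flag)
    show "orth b' (F' r) \<subseteq> f ` orth b (F r)"
    proof
      fix y assume y: "y \<in> orth b' (F' r)"
      obtain x where x: "y = f x" using surj by (metis surjD)
      have "x \<in> orth b (F r)" using y by (auto simp: orth_def form x simp flip: flag)
      then show "y \<in> f ` orth b (F r)" using x by blast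
    qed
  qed
  have block: "f ` (F q \<inter> orth b (F r)) = F' q \<inter> orth b' (F' r)" for q r
    by (simp add: image_Int[OF inj] flag orth)
  have num: "f ` N.num UNIV q r = N'.num UNIV q r" for q r
    using block[of q "r - 1"] by (simp add: N.num_def N'.num_def)
  have plus: "f ` (S + T) = f ` S + f ` T" for S T
    by (force simp: set_plus_def f.add image_iff)
  have den: "f ` N.den UNIV q r = N'.den UNIV q r" for q r
    using block[of q r] block[of "q - 1" "r - 1"] by (simp add: N.den_def N'.den_def plus)
  have dim: "N'.dim (f ` S) = N.dim S" for S
    using P.dim_image_eq[OF f(1)] inj by (simp add: inj_on_subset)
  show "n_inv scale b F q r = n_inv scale' b' F' q r"
    by (simp add: N.n_inv_eq_dim N'.n_inv_eq_dim dim flip: num den)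
  have iso: "f ` S \<subseteq> isotropic b' \<longleftrightarrow> S \<subseteq> isotropic b" for S
    by (auto simp: isotropic_def form)
  have "N.corner UNIV q r \<longleftrightarrow> N'.corner UNIV q r"
    by (simp add: N.corner_def N'.corner_def iso flip: num den)
  then show "n1_inv scale b F q r = n1_inv scale' b' F' q r"
    by (simp add: N.n1_inv_eq_corner N'.n1_inv_eq_corner)
qed

lemma invariants_eq_imp_equivalent:
  assumes "perfect_char_two_flagged_space scale b F"
    and "perfect_char_two_flagged_space scale' b' F'"
    and n: "\<And>q r. 1 \<le> q \<Longrightarrow> 1 \<le> r \<Longrightarrow> n_inv scale b F q r = n_inv scale' b' F' q r"
    and n1: "\<And>q r. 1 \<le> q \<Longrightarrow> 1 \<le> r \<Longrightarrow> n1_inv scale b F q r = n1_inv scale' b' F' q r"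
  shows "equivalent_triples scale b F scale' b' F'"
proof -
  interpret N: perfect_char_two_flagged_space scale b F by fact
  interpret N': perfect_char_two_flagged_space scale' b' F' by fact
  have C: "N.corner UNIV q r = N'.corner UNIV q r" if "1 \<le> q" "1 \<le> r" for q r
    using n1[OF that] by (simp add: N.n1_inv_eq_corner N'.n1_inv_eq_corner split: if_splits)
  obtain B \<sigma> R where B: "normal_basis_of_space scale b F (N.corner UNIV) B \<sigma> R"
    by (rule N.corner_normal_basis)
  obtain B' \<sigma>' R' where B': "normal_basis_of_space scale' b' F' (N'.corner UNIV) B' \<sigma>' R'"
    by (rule N'.corner_normal_basis)
  obtain \<psi> where \<psi>: "bij_betw \<psi> B B'"
    "\<forall>x\<in>B. N'.level (\<psi> x) = N.level x" "\<forall>x\<in>B. \<psi> (\<sigma> x) = \<sigma>' (\<psi> x)"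
    by (rule sigma_equivariant_bijection[OF B B' n C])
  show ?thesis by (rule equivalent_if_normal_bases_correspond[OF B B' C \<psi>])
qed

theorem theorem2p1:
  assumes "CHAR('k::field) = 2" and "perfect TYPE('k)"
  shows
    "(\<forall>(scale :: 'k \<Rightarrow> 'v::ab_group_add \<Rightarrow> 'v) b F.
        flagged_space scale b F \<longrightarrow>
        (\<exists>es m. vector_space.coordinated_basis scale F es \<and>
           matrix_of_form b es =
             diag_block_mat (replicate m M0 @ replicate (num_M1 scale b F) M1 @
                             [1\<^sub>m (size_one scale b F)]))) \<and>
     (\<forall>(scale :: 'k \<Rightarrow> 'v \<Rightarrow> 'v) b F (scale' :: 'k \<Rightarrow> 'w::ab_group_add \<Rightarrow> 'w) b' F'.
        flagged_space scale b F \<and> flagged_space scale' b' F' \<longrightarrow>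
        (equivalent_triples scale b F scale' b' F' \<longleftrightarrow>
         (\<forall>q\<ge>1. \<forall>r\<ge>1. n_inv scale b F q r = n_inv scale' b' F' q r \<and>
                       n1_inv scale b F q r = n1_inv scale' b' F' q r)))"
proof (intro conjI allI impI)
  fix scale :: "'k \<Rightarrow> 'v \<Rightarrow> 'v" and b F
  assume "flagged_space scale b F"
  then interpret flagged_space scale b F .
  interpret perfect_char_two_flagged_space scale b F by unfold_locales (rule assms)+
  show "\<exists>es m. coordinated_basis F es \<and>
      matrix_of_form b es = diag_block_mat (replicate m M0 @ replicate (num_M1 scale b F) M1 @
        [1\<^sub>m (size_one scale b F)])"
    by (rule diagonal_block_basis)
next
  fix scale :: "'k \<Rightarrow> 'v \<Rightarrow> 'v" and b F and scale' :: "'k \<Rightarrow> 'w \<Rightarrow> 'w" and b' F'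
  assume "flagged_space scale b F \<and> flagged_space scale' b' F'"
  then interpret V: flagged_space scale b F + W: flagged_space scale' b' F' by blast+
  have VW: "perfect_char_two_flagged_space scale b F" "perfect_char_two_flagged_space scale' b' F'"
    by (unfold_locales; rule assms)+
  show "equivalent_triples scale b F scale' b' F' \<longleftrightarrow>
      (\<forall>q\<ge>1. \<forall>r\<ge>1. n_inv scale b F q r = n_inv scale' b' F' q r \<and>
        n1_inv scale b F q r = n1_inv scale' b' F' q r)"
    using equivalent_imp_invariants_eq[OF VW] invariants_eq_imp_equivalent[OF VW] by blast
qed

end
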